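(* Let $A$ be a $\mathrm{C}^*$-algebra and let $H$ be a normal subgroup of $\mathrm{U}_A$. Let $I$ be the closed two-sided ideal of $A$ generated by $[H,A]$. Then $\overline{(H,\mathrm{U}_A)}=\overline{(\mathrm{U}_I,\mathrm{U}_A)}$.
   Context: $A$ is not assumed unital. $A^\sim$ denotes the minimal unitization of $A$ ($A^\sim=A$ if $A$ is unital). $\mathrm{U}(A)$ is the unitary group of $A$ if $A$ is unital; if $A$ is non-unital, $\mathrm{U}(A)$ is the group of unitaries of $A^\sim$ of the form $1+x$ with $x\in A$. It carries the norm topology, and $\mathrm{U}_A$ denotes its connected component of the identity. For a closed two-sided ideal $I$ of $A$, $I^\sim$ is regarded as a subalgebra of $A^\sim$ (elements $\lambda 1+x$ with $x\in I$, with $1$ the unit of $A^\sim$), and in this way $\mathrm{U}_I$ is regarded as a closed normal subgroup of $\mathrm{U}_A$. Write $[x,y]=xy-yx$ and $(x,y)=xyx^{-1}y^{-1}$ (for invertible $x,y$). For sets, $[X,Y]$ is the linear span of $\{[x,y]: x\in X,y\in Y\}$ and $(X,Y)$ is the subgroup generated by $\{(x,y): x\in X,y\in Y\}$. Overlines denote norm closure. *)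

theory Defs
  imports "HOL-Analysis.Analysis" "HOL-Algebra.Generated_Groups"
begin

section \<open>C*-algebras, not necessarily unital\<close>

class cstar_algebra = real_normed_algebra + complete_space +
  fixes scaleC :: "complex \<Rightarrow> 'a \<Rightarrow> 'a"  (infixr \<open>*\<^sub>C\<close> 75)
    and adj :: "'a \<Rightarrow> 'a"
  assumes scaleC_add_right: "c *\<^sub>C (x + y) = c *\<^sub>C x + c *\<^sub>C y"
    and scaleC_add_left: "(c + d) *\<^sub>C x = c *\<^sub>C x + d *\<^sub>C x"
    and scaleC_scaleC: "c *\<^sub>C d *\<^sub>C x = (c * d) *\<^sub>C x"
    and scaleR_scaleC: "r *\<^sub>R x = complex_of_real r *\<^sub>C x"
    and mult_scaleC_left: "(c *\<^sub>C x) * y = c *\<^sub>C (x * y)"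
    and mult_scaleC_right: "x * (c *\<^sub>C y) = c *\<^sub>C (x * y)"
    and norm_scaleC: "norm (c *\<^sub>C x) = cmod c * norm x"
    and adj_adj: "adj (adj x) = x"
    and adj_add: "adj (x + y) = adj x + adj y"
    and adj_mult: "adj (x * y) = adj y * adj x"
    and adj_scaleC: "adj (c *\<^sub>C x) = cnj c *\<^sub>C adj x"
    and cstar_identity: "norm (adj x * x) = (norm x)\<^sup>2"

lemma scaleC_one: "1 *\<^sub>C x = (x::'a::cstar_algebra)"
  using scaleR_scaleC[of 1 x] by simp

global_interpretation complex_vector: vector_space "scaleC :: complex \<Rightarrow> 'a \<Rightarrow> 'a::cstar_algebra"
  by unfold_locales (simp_all add: scaleC_add_right scaleC_add_left scaleC_scaleC scaleC_one)

lemma adj_zero: "adj 0 = (0::'a::cstar_algebra)"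
  using adj_add[of 0 "0::'a"] by simp

lemma norm_adj: "norm (adj x) = norm (x::'a::cstar_algebra)"
proof -
  have le: "norm y \<le> norm (adj y)" for y :: 'a
  proof (cases "y = 0")
    case False
    have "norm y * norm y \<le> norm (adj y) * norm y"
      using norm_mult_ineq[of "adj y" y] by (simp add: cstar_identity power2_eq_square)
    then show ?thesis using False by simp
  qed (simp add: adj_zero)
  show ?thesis using le[of x] le[of "adj x"] by (simp add: adj_adj)
qed

definition is_unit_elt :: "'a::cstar_algebra \<Rightarrow> bool" where
  "is_unit_elt e \<longleftrightarrow> (\<forall>x. e * x = x \<and> x * e = x)"

definition unital_algebra :: "'a::cstar_algebra itself \<Rightarrow> bool" where
  "unital_algebra _ \<longleftrightarrow> (\<exists>e::'a. is_unit_elt e)"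

definition closed_ideal :: "'a::cstar_algebra set \<Rightarrow> bool" where
  "closed_ideal J \<longleftrightarrow> closed J \<and> complex_vector.subspace J \<and>
     (\<forall>a. \<forall>x\<in>J. a * x \<in> J \<and> x * a \<in> J)"

definition comm_span :: "'a::cstar_algebra set \<Rightarrow> 'a set \<Rightarrow> 'a set" where
  "comm_span X Y = complex_vector.span {x * y - y * x | x y. x \<in> X \<and> y \<in> Y}"


section \<open>The minimal unitization\<close>

text \<open>A pair \<^term>\<open>(l, x)\<close> stands for \<open>l 1 + x\<close>. If the algebra has a unit, only the pairs
  \<^term>\<open>(0, x)\<close> occur, so that the minimal unitization is then the algebra itself.\<close>

typedef (overloaded) 'a unitization =
    "{(l::complex, x::'a::cstar_algebra). unital_algebra TYPE('a) \<longrightarrow> l = 0}"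
  by (rule exI[of _ "(0, 0)"]) simp

setup_lifting type_definition_unitization

lift_definition scal :: "'a::cstar_algebra unitization \<Rightarrow> complex" is fst .
lift_definition part :: "'a::cstar_algebra unitization \<Rightarrow> 'a" is snd .
lift_definition emb :: "'a::cstar_algebra \<Rightarrow> 'a unitization" is "\<lambda>x. (0, x)" by simp

lemma unitization_eq_iff: "u = v \<longleftrightarrow> scal u = scal v \<and> part u = part v"
  by transfer auto

lemma scal_unital: "unital_algebra TYPE('a) \<Longrightarrow> scal (u::'a::cstar_algebra unitization) = 0"
  by transfer auto

lemma scal_emb [simp]: "scal (emb x) = 0" and part_emb [simp]: "part (emb x) = x"
  by (transfer, simp)+

definition lact :: "'a::cstar_algebra unitization \<Rightarrow> 'a \<Rightarrow> 'a" where
  "lact u b = scal u *\<^sub>C b + part u * b"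

instantiation unitization :: (cstar_algebra) ring
begin
lift_definition zero_unitization :: "'a unitization" is "(0, 0)" by simp
lift_definition plus_unitization :: "'a unitization \<Rightarrow> 'a unitization \<Rightarrow> 'a unitization"
  is "\<lambda>(l, x) (m, y). (l + m, x + y)" by auto
lift_definition uminus_unitization :: "'a unitization \<Rightarrow> 'a unitization"
  is "\<lambda>(l, x). (- l, - x)" by auto
lift_definition minus_unitization :: "'a unitization \<Rightarrow> 'a unitization \<Rightarrow> 'a unitization"
  is "\<lambda>(l, x) (m, y). (l - m, x - y)" by auto
lift_definition times_unitization :: "'a unitization \<Rightarrow> 'a unitization \<Rightarrow> 'a unitization"
  is "\<lambda>(l, x) (m, y). (l * m, l *\<^sub>C y + m *\<^sub>C x + x * y)" by auto
instance
  by (intro_classes; transfer)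
    (auto simp: algebra_simps scaleC_add_right scaleC_add_left scaleC_scaleC
      mult_scaleC_left mult_scaleC_right)
end

instantiation unitization :: (cstar_algebra) real_vector
begin
lift_definition scaleR_unitization :: "real \<Rightarrow> 'a unitization \<Rightarrow> 'a unitization"
  is "\<lambda>r (l, x). (complex_of_real r * l, r *\<^sub>R x)" by auto
instance
  by (intro_classes; transfer) (auto simp: algebra_simps)
end

instantiation unitization :: (cstar_algebra) monoid_mult
begin
lift_definition one_unitization :: "'a unitization"
  is "if unital_algebra TYPE('a) then (0, THE e. is_unit_elt e) else (1, 0)" by simp
instance
proof
  fix u :: "'a unitization"
  have e: "is_unit_elt (THE e::'a. is_unit_elt e)" if "unital_algebra TYPE('a)"
    using that unfolding unital_algebra_def
    by (metis (mono_tags, lifting) is_unit_elt_def theI)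
  show "1 * u = u" using e
    by transfer (auto simp: scaleC_one is_unit_elt_def)
  show "u * 1 = u" using e
    by transfer (auto simp: scaleC_one is_unit_elt_def)
qed
end

lemma unitization_sels [simp]:
  "scal 0 = 0" "part 0 = 0"
  "scal (u + v) = scal u + scal v" "part (u + v) = part u + part v"
  "scal (- u) = - scal u" "part (- u) = - part u"
  "scal (u - v) = scal u - scal v" "part (u - v) = part u - part v"
  "scal (u * v) = scal u * scal v"
  "part (u * v) = scal u *\<^sub>C part v + scal v *\<^sub>C part u + part u * part v"
  "scal (r *\<^sub>R u) = complex_of_real r * scal u" "part (r *\<^sub>R u) = r *\<^sub>R part u"
  by (transfer, auto)+

lemma bounded_linear_scaleC: "bounded_linear (\<lambda>b::'a::cstar_algebra. c *\<^sub>C b)"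
  by (rule bounded_linear_intro[of _ "cmod c"])
    (simp_all add: scaleC_add_right scaleR_scaleC scaleC_scaleC norm_scaleC mult.commute)

lemma bounded_linear_lact: "bounded_linear (lact u)"
  unfolding lact_def
  by (intro bounded_linear_add bounded_linear_scaleC bounded_linear_mult_right)

lemma lact_mult: "lact (u * v) = lact u \<circ> lact v"
  by (rule ext) (simp add: lact_def algebra_simps scaleC_add_right scaleC_add_left scaleC_scaleC
      mult_scaleC_left mult_scaleC_right)

lemma lact_add: "lact (u + v) = (\<lambda>b. lact u b + lact v b)"
  by (rule ext) (simp add: lact_def algebra_simps scaleC_add_left)

lemma lact_scaleR: "lact (r *\<^sub>R u) = (\<lambda>b. r *\<^sub>R lact u b)"
  by (rule ext) (simp add: lact_def scaleR_scaleC scaleC_add_right scaleC_scaleC mult_scaleC_left)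

lemma lact_eq_0:
  assumes "\<And>b. lact u b = (0::'a::cstar_algebra)" shows "u = 0"
proof -
  have s: "scal u = 0"
  proof (rule ccontr)
    assume ne: "scal u \<noteq> 0"
    define e where "e = (- inverse (scal u)) *\<^sub>C part u"
    have l: "e * b = b" for b
    proof -
      have "part u * b = - (scal u *\<^sub>C b)"
        using assms[of b] by (simp add: lact_def eq_neg_iff_add_eq_0 add.commute)
      then have "e * b = (- inverse (scal u)) *\<^sub>C (- (scal u *\<^sub>C b))"
        by (simp add: e_def mult_scaleC_left)
      also have "\<dots> = (inverse (scal u) * scal u) *\<^sub>C b"
        by (metis complex_vector.scale_minus_left complex_vector.scale_minus_right minus_minus
            scaleC_scaleC)
      finally show ?thesis using ne by (simp add: scaleC_one)
    qed
    have r: "b * adj e = b" for b using l[of "adj b"] by (metis adj_adj adj_mult)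
    have "adj e = e" using l[of "adj e"] r[of e] by simp
    then have "is_unit_elt e" using l r by (auto simp: is_unit_elt_def)
    then have "unital_algebra TYPE('a)" by (auto simp: unital_algebra_def)
    then show False using ne scal_unital by blast
  qed
  have "norm (adj (part u)) = 0"
    using assms[of "adj (part u)"] s cstar_identity[of "adj (part u)"] by (simp add: lact_def adj_adj)
  then have "part u = 0" by (simp add: norm_adj)
  with s show ?thesis by (simp add: unitization_eq_iff)
qed

text \<open>The norm of an element of the unitization is the norm of its left multiplication
  operator on the original algebra; this is the unique C*-norm extending the given one.\<close>

instantiation unitization :: (cstar_algebra) real_normed_algebra
begin
definition norm_unitization :: "'a unitization \<Rightarrow> real" where
  "norm_unitization u = onorm (lact u)"
definition dist_unitization :: "'a unitization \<Rightarrow> 'a unitization \<Rightarrow> real" where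
  "dist_unitization u v = norm (u - v)"
definition sgn_unitization :: "'a unitization \<Rightarrow> 'a unitization" where
  "sgn_unitization u = u /\<^sub>R norm u"
definition uniformity_unitization :: "('a unitization \<times> 'a unitization) filter" where
  "uniformity_unitization = (INF e\<in>{0 <..}. principal {(x, y). dist x y < e})"
definition open_unitization :: "'a unitization set \<Rightarrow> bool" where
  "open_unitization U \<longleftrightarrow> (\<forall>x\<in>U. \<forall>\<^sub>F (x', y) in uniformity. x' = x \<longrightarrow> y \<in> U)"
instance
proof
  fix u v w :: "'a unitization" and r :: real
  show "dist u v = norm (u - v)" by (rule dist_unitization_def)
  show "sgn u = u /\<^sub>R norm u" by (rule sgn_unitization_def)
  show "(uniformity :: ('a unitization \<times> 'a unitization) filter) =
      (INF e\<in>{0 <..}. principal {(x, y). dist x y < e})" by (rule uniformity_unitization_def)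
  show "open U \<longleftrightarrow> (\<forall>x\<in>U. \<forall>\<^sub>F (x', y) in uniformity. x' = x \<longrightarrow> y \<in> U)"
    for U :: "'a unitization set" by (rule open_unitization_def)
  show "(norm u = 0) = (u = 0)"
    unfolding norm_unitization_def onorm_eq_0[OF bounded_linear_lact]
    using lact_eq_0 by (auto simp: lact_def)
  show "norm (u + v) \<le> norm u + norm v"
    unfolding norm_unitization_def lact_add
    by (rule onorm_triangle[OF bounded_linear_lact bounded_linear_lact])
  show "norm (r *\<^sub>R u) = \<bar>r\<bar> * norm u"
    unfolding norm_unitization_def lact_scaleR by (rule onorm_scaleR[OF bounded_linear_lact])
  show "norm (u * v) \<le> norm u * norm v"
    unfolding norm_unitization_def lact_mult
    by (rule onorm_compose[OF bounded_linear_lact bounded_linear_lact])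
  show "r *\<^sub>R u * v = r *\<^sub>R (u * v)" "u * r *\<^sub>R v = r *\<^sub>R (u * v)"
    by (simp_all add: unitization_eq_iff scaleR_scaleC scaleC_add_right scaleC_scaleC
      mult_scaleC_left mult_scaleC_right mult.commute mult.left_commute)
qed
end

lemma norm_lact_le: "norm (lact u b) \<le> norm u * norm b"
  unfolding norm_unitization_def by (rule onorm[OF bounded_linear_lact])

lemma norm_emb: "norm (emb x) = norm (x::'a::cstar_algebra)"
proof (rule antisym)
  show "norm (emb x) \<le> norm x"
    unfolding norm_unitization_def
    by (rule onorm_bound) (simp_all add: lact_def norm_mult_ineq)
  show "norm x \<le> norm (emb x)"
  proof (cases "x = 0")
    case False
    have "norm x * norm x \<le> norm (emb x) * norm x"
      using norm_lact_le[of "emb x" "adj x"] cstar_identity[of "adj x"]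
      by (simp add: lact_def adj_adj norm_adj power2_eq_square)
    then show ?thesis using False by simp
  qed simp
qed

lemma emb_algebra:
  "emb (x + y) = emb x + emb y" "emb (x - y) = emb x - emb y" "emb (x * y) = emb x * emb y"
  "emb 0 = 0"
  by (simp_all add: unitization_eq_iff)

lemma scal_one: "\<not> unital_algebra TYPE('a) \<Longrightarrow> scal (1::'a::cstar_algebra unitization) = 1"
  and part_one: "\<not> unital_algebra TYPE('a) \<Longrightarrow> part (1::'a::cstar_algebra unitization) = 0"
  by (transfer, simp)+

lemma complete_range_emb: "complete (range (emb :: 'a::cstar_algebra \<Rightarrow> _))"
proof (rule completeI)
  fix f :: "nat \<Rightarrow> 'a unitization"
  assume "\<forall>n. f n \<in> range emb" and c: "Cauchy f"
  then have f: "f n = emb (part (f n))" for n by (metis part_emb rangeE)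
  have d: "dist (part (f m)) (part (f n)) = dist (f m) (f n)" for m n
    by (metis f dist_norm emb_algebra(2) norm_emb)
  have "Cauchy (\<lambda>n. part (f n))" using c by (simp add: Cauchy_def d)
  then obtain x where "(\<lambda>n. part (f n)) \<longlonglongrightarrow> x" using Cauchy_convergent_iff convergent_def by blast
  then have "f \<longlonglongrightarrow> emb x"
    unfolding tendsto_iff by (metis (no_types, lifting) d dist_norm emb_algebra(2) eventually_mono f norm_emb)
  then show "\<exists>l\<in>range emb. f \<longlonglongrightarrow> l" by blast
qed

lemma dist_diff_le:
  fixes x y a b :: "'b::real_normed_vector"
  shows "dist (x - a) (y - b) \<le> dist x y + dist a b"
proof -
  have "x - a - (y - b) = (x - y) - (a - b)" by simp
  then show ?thesis unfolding dist_norm by (metis norm_triangle_ineq4)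
qed

instantiation unitization :: (cstar_algebra) cstar_algebra
begin
lift_definition scaleC_unitization :: "complex \<Rightarrow> 'a unitization \<Rightarrow> 'a unitization"
  is "\<lambda>c (l, x). (c * l, c *\<^sub>C x)" by auto
lift_definition adj_unitization :: "'a unitization \<Rightarrow> 'a unitization"
  is "\<lambda>(l, x). (cnj l, adj x)" by auto
instance
proof
  fix u v w :: "'a unitization" and r :: real and c d :: complex
  have [simp]: "scal (c *\<^sub>C u) = c * scal u" "part (c *\<^sub>C u) = c *\<^sub>C part u"
    "scal (adj u) = cnj (scal u)" "part (adj u) = adj (part u)" for c and u :: "'a unitization"
    by (transfer, auto)+
  note simps = unitization_eq_iff scaleR_scaleC scaleC_add_right scaleC_add_left scaleC_scaleC
      mult_scaleC_left mult_scaleC_right adj_add adj_mult adj_scaleC adj_adj algebra_simps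
  show "c *\<^sub>C (u + v) = c *\<^sub>C u + c *\<^sub>C v" "(c + d) *\<^sub>C u = c *\<^sub>C u + d *\<^sub>C u"
    "c *\<^sub>C d *\<^sub>C u = (c * d) *\<^sub>C u" "r *\<^sub>R u = complex_of_real r *\<^sub>C u"
    "(c *\<^sub>C u) * v = c *\<^sub>C (u * v)" "u * (c *\<^sub>C v) = c *\<^sub>C (u * v)"
    "adj (adj u) = u" "adj (u + v) = adj u + adj v" "adj (u * v) = adj v * adj u"
    "adj (c *\<^sub>C u) = cnj c *\<^sub>C adj u"
    by (simp_all add: simps)
  have scC: "lact (c *\<^sub>C u) = (\<lambda>b. c *\<^sub>C lact u b)" for c and u :: "'a unitization"
    by (rule ext) (simp add: lact_def simps)
  have le: "norm (c *\<^sub>C u) \<le> cmod c * norm u" for c and u :: "'a unitization"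
    unfolding norm_unitization_def[of "c *\<^sub>C u"] scC
    using norm_lact_le[of u] by (intro onorm_bound) (simp_all add: norm_scaleC mult_left_mono mult.assoc)
  have norm_sc: "norm (c *\<^sub>C u) = cmod c * norm u" for c and u :: "'a unitization"
  proof (cases "c = 0")
    case False
    have "norm (inverse c *\<^sub>C c *\<^sub>C u) \<le> inverse (cmod c) * norm (c *\<^sub>C u)"
      using le[of "inverse c" "c *\<^sub>C u"] by (simp add: norm_inverse)
    moreover have "inverse c *\<^sub>C c *\<^sub>C u = u" using False by (simp add: simps scaleC_one)
    ultimately have "cmod c * norm u \<le> norm (c *\<^sub>C u)" using False by (simp add: field_simps)
    with le show ?thesis by (simp add: antisym)
  next
    case True
    with le[of 0 u] show ?thesis by simp
  qed
  then show "norm (c *\<^sub>C u) = cmod c * norm u" .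
  have sq: "(norm u)\<^sup>2 \<le> norm (adj u * u)" for u :: "'a unitization"
  proof -
    have b: "norm (lact u b) \<le> sqrt (norm (adj u * u)) * norm b" for b
    proof -
      have "adj (lact u b) * lact u b = adj b * lact (adj u * u) b"
        by (simp add: lact_def simps)
      then have "(norm (lact u b))\<^sup>2 = norm (adj b * lact (adj u * u) b)"
        by (metis cstar_identity)
      also have "\<dots> \<le> norm b * (norm (adj u * u) * norm b)"
        by (rule order_trans[OF norm_mult_ineq])
          (simp add: norm_adj mult_left_mono norm_lact_le)
      also have "\<dots> = (sqrt (norm (adj u * u)) * norm b)\<^sup>2"
        by (simp add: power_mult_distrib) (simp add: power2_eq_square)
      finally show ?thesis by (rule power2_le_imp_le) simp
    qed
    have "norm u \<le> sqrt (norm (adj u * u))"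
      unfolding norm_unitization_def[of u] by (rule onorm_bound) (simp_all add: b)
    then show ?thesis by (metis norm_ge_zero power_mono real_sqrt_pow2)
  qed
  have n: "norm u \<le> norm (adj u)" for u :: "'a unitization"
  proof (cases "u = 0")
    case False
    have "norm u * norm u \<le> norm (adj u) * norm u"
      using sq[of u] norm_mult_ineq[of "adj u" u] by (simp add: power2_eq_square)
    then show ?thesis using False by simp
  qed simp
  have "adj (adj u) = u" by (simp add: simps)
  then have "norm (adj u) = norm u" using n[of u] n[of "adj u"] by simp
  then show "norm (adj u * u) = (norm u)\<^sup>2"
    using sq[of u] norm_mult_ineq[of "adj u" u] by (simp add: power2_eq_square)
  show "convergent X" if C: "Cauchy X" for X :: "nat \<Rightarrow> 'a unitization"
  proof (cases "unital_algebra TYPE('a)")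
    case True
    then have "\<forall>n. X n \<in> range emb"
      by (metis part_emb rangeI scal_emb scal_unital unitization_eq_iff)
    then show ?thesis using complete_range_emb C unfolding complete_def convergent_def by blast
  next
    case False
    note [simp] = scal_one[OF False] part_one[OF False]
    have "(1::'a unitization) \<notin> range emb" by (force simp: unitization_eq_iff)
    moreover have "closed (range (emb::'a \<Rightarrow> _))"
      by (rule complete_imp_closed[OF complete_range_emb])
    ultimately obtain \<delta> where \<delta>: "\<delta> > 0" and "ball (1::'a unitization) \<delta> \<subseteq> - range emb"
      by (metis ComplI open_Compl open_contains_ball)
    then have far: "\<delta> \<le> norm (1 - emb x)" for x :: 'a
      by (metis ComplD dist_norm in_mono mem_ball not_le_imp_less rangeI)
    have scal_le: "cmod (scal u) * \<delta> \<le> norm u" for u :: "'a unitization"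
    proof (cases "scal u = 0")
      case ne: False
      have "u = scal u *\<^sub>C (1 - emb ((- inverse (scal u)) *\<^sub>C part u))"
        using ne by (simp add: unitization_eq_iff scaleC_scaleC scaleC_one)
      then have "norm u = cmod (scal u) * norm (1 - emb ((- inverse (scal u)) *\<^sub>C part u))"
        by (metis norm_sc)
      then show ?thesis using far by (metis mult_left_mono norm_ge_zero)
    qed simp
    have "Cauchy (\<lambda>n. scal (X n))"
    proof (rule metric_CauchyI)
      fix e :: real assume "e > 0"
      then obtain M where M: "\<And>m n. m \<ge> M \<Longrightarrow> n \<ge> M \<Longrightarrow> norm (X m - X n) < e * \<delta>"
        using metric_CauchyD[OF C, of "e * \<delta>"] \<delta> by (auto simp: dist_norm)
      have "dist (scal (X m)) (scal (X n)) < e" if "m \<ge> M" "n \<ge> M" for m n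
      proof -
        have "dist (scal (X m)) (scal (X n)) * \<delta> < e * \<delta>"
          using scal_le[of "X m - X n"] M[OF that] by (simp add: dist_norm)
        then show ?thesis using \<delta> by simp
      qed
      then show "\<exists>M. \<forall>m\<ge>M. \<forall>n\<ge>M. dist (scal (X m)) (scal (X n)) < e" by blast
    qed
    then obtain l where l: "(\<lambda>n. scal (X n)) \<longlonglongrightarrow> l"
      using Cauchy_convergent_iff convergent_def by blast
    have "(\<lambda>n. cmod (scal (X n) - l) * norm (1::'a unitization)) \<longlonglongrightarrow> 0"
      by (intro tendsto_mult_left_zero tendsto_norm_zero LIM_zero l)
    then have "(\<lambda>n. norm (scal (X n) *\<^sub>C (1::'a unitization) - l *\<^sub>C 1)) \<longlonglongrightarrow> 0"
    proof (rule Lim_transform_eventually)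
      have *: "scal (X n) *\<^sub>C (1::'a unitization) - l *\<^sub>C 1 = (scal (X n) - l) *\<^sub>C 1" for n
        by (simp add: unitization_eq_iff)
      show "\<forall>\<^sub>F n in sequentially. cmod (scal (X n) - l) * norm (1::'a unitization)
          = norm (scal (X n) *\<^sub>C (1::'a unitization) - l *\<^sub>C 1)"
        unfolding * norm_sc by simp
    qed
    then have lim1: "(\<lambda>n. scal (X n) *\<^sub>C (1::'a unitization)) \<longlonglongrightarrow> l *\<^sub>C 1"
      by (rule LIM_zero_cancel[OF tendsto_norm_zero_cancel])
    have Y: "X n - scal (X n) *\<^sub>C 1 = emb (part (X n))" for n
      by (simp add: unitization_eq_iff)
    have "Cauchy (\<lambda>n. X n - scal (X n) *\<^sub>C 1)"
    proof (rule metric_CauchyI)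
      fix e :: real assume "e > 0"
      then have "e / 2 > 0" by simp
      obtain M where M: "\<And>m n. m \<ge> M \<Longrightarrow> n \<ge> M \<Longrightarrow> dist (X m) (X n) < e / 2"
        using metric_CauchyD[OF C \<open>e / 2 > 0\<close>] by blast
      obtain N where N: "\<And>m n. m \<ge> N \<Longrightarrow> n \<ge> N \<Longrightarrow>
          dist (scal (X m) *\<^sub>C (1::'a unitization)) (scal (X n) *\<^sub>C 1) < e / 2"
        using metric_CauchyD[OF LIMSEQ_imp_Cauchy[OF lim1] \<open>e / 2 > 0\<close>] by blast
      have "dist (X m - scal (X m) *\<^sub>C 1) (X n - scal (X n) *\<^sub>C 1) < e"
        if "m \<ge> max M N" "n \<ge> max M N" for m n
      proof -
        have "dist (X m - scal (X m) *\<^sub>C 1) (X n - scal (X n) *\<^sub>C 1)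
            \<le> dist (X m) (X n) + dist (scal (X m) *\<^sub>C (1::'a unitization)) (scal (X n) *\<^sub>C 1)"
          by (rule dist_diff_le)
        then show ?thesis using M[of m n] N[of m n] that by linarith
      qed
      then show "\<exists>M. \<forall>m\<ge>M. \<forall>n\<ge>M.
          dist (X m - scal (X m) *\<^sub>C 1) (X n - scal (X n) *\<^sub>C 1) < e" by blast
    qed
    then have "Cauchy (\<lambda>n. emb (part (X n)))" unfolding Y .
    then obtain y where "(\<lambda>n. emb (part (X n))) \<longlonglongrightarrow> y"
      using completeE[OF complete_range_emb, of "\<lambda>n. emb (part (X n))"] by auto
    then have "(\<lambda>n. X n - scal (X n) *\<^sub>C 1) \<longlonglongrightarrow> y" unfolding Y .
    from tendsto_add[OF this lim1] have "X \<longlonglongrightarrow> y + l *\<^sub>C 1" by simp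
    then show ?thesis by (rule convergentI)
  qed
qed
end

text \<open>Commutators with elements of the algebra lie in the algebra, so that taking the preimage
  under \<^const>\<open>emb\<close> of such a span loses nothing.\<close>

lemma comm_span_subset: "comm_span H (range emb) \<subseteq> range (emb :: 'a::cstar_algebra \<Rightarrow> _)"
  unfolding comm_span_def
proof (rule complex_vector.span_minimal)
  have in_range: "u \<in> range emb" if "scal u = 0" for u :: "'a unitization"
    using that by (intro range_eqI[of _ _ "part u"]) (simp add: unitization_eq_iff)
  have "scal (c *\<^sub>C u) = c * scal u" for c and u :: "'a unitization"
    by transfer auto
  then show "complex_vector.subspace (range (emb :: 'a \<Rightarrow> _))"
    by (intro complex_vector.subspaceI in_range) auto
  show "{x * y - y * x |x y. x \<in> H \<and> y \<in> range emb} \<subseteq> range (emb :: 'a \<Rightarrow> _)"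
    by (auto intro!: in_range)
qed


section \<open>Unitary groups\<close>

definition unitary :: "'a::{cstar_algebra, monoid_mult} \<Rightarrow> bool" where
  "unitary u \<longleftrightarrow> adj u * u = 1 \<and> u * adj u = 1"

text \<open>\<^term>\<open>unitaries J\<close> is the unitary group of a closed two-sided ideal \<open>J\<close>, regarded as a set of
  elements of the unitization of the whole algebra. For \<open>J = UNIV\<close> these are the unitaries
  of the form \<open>1 + x\<close>; if the algebra is unital, then these are all unitaries. If \<open>J\<close> has a unit
  \<open>p\<close> of its own, a unitary \<open>v\<close> of \<open>J\<close> (so that \<open>adj v * v = p = v * adj v\<close>)
  appears as \<open>1 + (v - p)\<close>.\<close>

definition unitaries :: "'a::cstar_algebra set \<Rightarrow> 'a unitization set" where
  "unitaries J = {u. unitary u \<and> (\<exists>x\<in>J. u = 1 + emb x)}"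

definition unitaries0 :: "'a::cstar_algebra set \<Rightarrow> 'a unitization set" where
  "unitaries0 J = connected_component_set (unitaries J) 1"

definition unitary_group0 :: "'a::cstar_algebra unitization monoid" where
  "unitary_group0 = \<lparr>carrier = unitaries0 UNIV, monoid.mult = (*), one = 1\<rparr>"

definition comm_subgroup :: "('g, 'm) monoid_scheme \<Rightarrow> 'g set \<Rightarrow> 'g set \<Rightarrow> 'g set" where
  "comm_subgroup G X Y = generate G
     {x \<otimes>\<^bsub>G\<^esub> y \<otimes>\<^bsub>G\<^esub> inv\<^bsub>G\<^esub> x \<otimes>\<^bsub>G\<^esub> inv\<^bsub>G\<^esub> y | x y. x \<in> X \<and> y \<in> Y}"

lemma adj_one: "adj 1 = (1::'a::{cstar_algebra, monoid_mult})"
  by (metis adj_adj adj_mult mult.left_neutral mult.right_neutral)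

lemma unitaries_unital:
  "unital_algebra TYPE('a::cstar_algebra) \<Longrightarrow> unitaries (UNIV::'a set) = {u. unitary u}"
proof -
  assume "unital_algebra TYPE('a)"
  then have "u = 1 + emb (part u - part 1)" for u :: "'a unitization"
    by (simp add: unitization_eq_iff scal_unital)
  then show ?thesis by (auto simp: unitaries_def)
qed

lemma unitaries_one: "closed_ideal J \<Longrightarrow> 1 \<in> unitaries J"
  by (auto simp: unitaries_def unitary_def adj_one closed_ideal_def emb_algebra
      complex_vector.subspace_0 intro!: bexI[of _ 0])

lemma unitaries_mult: 
  assumes "closed_ideal J" "u \<in> unitaries J" "v \<in> unitaries J"
  shows "u * v \<in> unitaries J"
proof -
  from assms obtain x y where u: "unitary u" "x \<in> J" "u = 1 + emb x"
    and v: "unitary v" "y \<in> J" "v = 1 + emb y" by (auto simp: unitaries_def)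
  have "u * v = 1 + emb (x + y + x * y)"
    by (simp add: u v algebra_simps emb_algebra)
  moreover have "x + y + x * y \<in> J"
    using assms(1) u v by (auto simp: closed_ideal_def complex_vector.subspace_add)
  moreover have "unitary (u * v)"
    using u(1) v(1) unfolding unitary_def adj_mult by (metis mult.assoc mult.left_neutral)
  ultimately show ?thesis by (auto simp: unitaries_def)
qed

lemma closed_ideal_UNIV: "closed_ideal UNIV"
  by (simp add: closed_ideal_def complex_vector.subspace_UNIV)

lemma adj_in_unitaries:
  assumes "u \<in> unitaries (UNIV::'a::cstar_algebra set)" shows "adj u \<in> unitaries (UNIV::'a set)"
proof -
  from assms obtain x where u: "unitary u" "u = 1 + emb x" by (auto simp: unitaries_def)
  have "adj (emb x) = emb (adj x)" by (transfer) simp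
  then have "adj u = 1 + emb (adj x)" by (simp add: u(2) adj_add adj_one)
  moreover have "unitary (adj u)" using u(1) by (simp add: unitary_def adj_adj)
  ultimately show ?thesis by (auto simp: unitaries_def)
qed

lemma unitaries0_subset: "unitaries0 J \<subseteq> unitaries J"
  unfolding unitaries0_def by (rule connected_component_subset)

lemma unitaries0_mono: "J \<subseteq> K \<Longrightarrow> unitaries0 J \<subseteq> unitaries0 K"
  unfolding unitaries0_def by (rule connected_component_mono) (auto simp: unitaries_def)

text \<open>A left translation that maps some element of the component into the component
  preserves the component.\<close>

lemma unitaries0_translate:
  assumes g: "g \<in> unitaries (UNIV::'a::cstar_algebra set)"
    and v: "v \<in> unitaries0 UNIV" "g * v \<in> unitaries0 UNIV" and w: "w \<in> unitaries0 UNIV"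
  shows "g * w \<in> unitaries0 (UNIV::'a set)"
proof -
  let ?T = "(\<lambda>x. g * x) ` unitaries0 UNIV"
  have "connected ?T"
    unfolding unitaries0_def
    by (intro connected_continuous_image connected_connected_component continuous_intros)
  moreover have "?T \<subseteq> unitaries UNIV"
    using unitaries_mult[OF closed_ideal_UNIV g] unitaries0_subset by blast
  ultimately have "?T \<subseteq> connected_component_set (unitaries UNIV) (g * v)"
    using v(1) by (intro connected_component_maximal) auto
  also have "\<dots> = unitaries0 UNIV"
    using v(2) unfolding unitaries0_def by (simp add: connected_component_eq)
  finally show ?thesis using w by blast
qed

lemma unitaries0_one: "1 \<in> unitaries0 (UNIV::'a::cstar_algebra set)"
  unfolding unitaries0_def using unitaries_one[OF closed_ideal_UNIV]
  by (simp add: connected_component_refl)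

lemma group_unitary_group0: "group (unitary_group0 :: 'a::cstar_algebra unitization monoid)"
proof (rule groupI)
  fix u v w :: "'a unitization"
  assume "u \<in> carrier unitary_group0"
  then have u: "u \<in> unitaries0 UNIV" by (simp add: unitary_group0_def)
  then have uU: "u \<in> unitaries UNIV" using unitaries0_subset by blast
  have "adj u * u = 1" using uU by (auto simp: unitaries_def unitary_def)
  moreover have "adj u \<in> unitaries0 UNIV"
    using unitaries0_translate[OF adj_in_unitaries[OF uU] u _ unitaries0_one] unitaries0_one
      \<open>adj u * u = 1\<close> by simp
  ultimately show "\<exists>y\<in>carrier unitary_group0. y \<otimes>\<^bsub>unitary_group0\<^esub> u = \<one>\<^bsub>unitary_group0\<^esub>"
    by (auto simp: unitary_group0_def)
  show "u \<otimes>\<^bsub>unitary_group0\<^esub> v \<in> carrier unitary_group0" if "v \<in> carrier unitary_group0"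
    using unitaries0_translate[OF uU unitaries0_one] u that by (simp add: unitary_group0_def)
qed (simp_all add: unitary_group0_def unitaries0_one mult.assoc)

end

theory Submission
  imports Defs
begin

text \<open>Both inclusions are comparisons of a closed normal subgroup \<open>N\<close> of \<open>U\<^sub>A\<close> with its tangent directions, the
skew-adjoint \<open>x\<close> such that \<open>exp (t x) \<in> N\<close> for all real \<open>t\<close>. By the Lie--Trotter formula these form a closed
real subspace, and it decides membership of commutators: if \<open>N\<close> contains \<open>(u, exp (t a))\<close> for all \<open>t\<close>, then
\<open>u a u\<^sup>* - a\<close> is tangent (\<open>conj_diff_in_tangent\<close>), and conversely if \<open>u a u\<^sup>* - a\<close> is tangent, then \<open>(u, exp a) \<in> N\<close>
(\<open>commutator_in\<close>). Since the exponentials of skew-adjoint elements of \<open>A\<close> topologically generate \<open>U\<^sub>A\<close>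
(\<open>UA_topological_induct\<close>), it is enough to decide which differences \<open>u a u\<^sup>* - a\<close> are tangent.

Let \<open>N\<close> be the closure of \<open>(U\<^sub>I, U\<^sub>A)\<close> and let \<open>h \<in> H\<close>. The difference \<open>d = h a h\<^sup>* - a\<close> lies in \<open>I\<close>, but it has to be
obtained from commutators with \<open>U\<^sub>I\<close>. For \<open>c \<in> I\<close> the commutator of \<open>h\<close> with \<open>exp (t c) \<in> U\<^sub>I\<close> belongs to \<open>N\<close>, so
that \<open>h c h\<^sup>* - c\<close> is tangent. Let \<open>c\<^sub>n\<close> be \<open>a\<close> minus the average of \<open>h\<^sup>k a h\<^sup>-\<^sup>k\<close> over \<open>k < n\<close>. Then \<open>c\<^sub>n \<in> I\<close>, and \<open>h c\<^sub>n h\<^sup>* - c\<^sub>n\<close>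
converges to \<open>d\<close> because the average is almost invariant under conjugation by \<open>h\<close>
(\<open>conj_diff_ergodic_limit\<close>). Hence \<open>d\<close> is tangent.

Let \<open>N\<close> be the closure of \<open>(H, U\<^sub>A)\<close>. Its complexified tangent space \<open>V\<close> contains \<open>[H, A]\<close>, and for \<open>v = 1 + x \<in> U\<^sub>I\<close>
the difference \<open>v a v\<^sup>* - a\<close> is the commutator \<open>[x, a v\<^sup>*]\<close>, so that \<open>[I, A] \<subseteq> V\<close> has to be shown. The closed span \<open>L\<close>
of \<open>H\<close> is a Lie ideal, by differentiating conjugation by \<open>exp (t a)\<close>. The identity
\<open>[x y, a] = [x, y a] + [y, a x]\<close> gives \<open>[L L, A] \<subseteq> V\<close>, and the ideal generated by \<open>[L, L]\<close> is contained in
\<open>L + L L\<close> up to closure (\<open>lie_hull_subset\<close>). That ideal already contains \<open>[L, A]\<close>, and hence \<open>I\<close>, because closed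
ideals of C*-algebras are semiprime (\<open>commutator_in_lie_hull\<close>).\<close>

instance cstar_algebra \<subseteq> banach ..

section \<open>The exponential map\<close>

lemma norm_one_le: "norm (1 :: 'b::{cstar_algebra, monoid_mult}) \<le> 1"
proof -
  have "(norm (1::'b))\<^sup>2 = norm (1::'b)"
    using cstar_identity[of "1::'b"] by (simp add: adj_one)
  then have "norm (1::'b) = 0 \<or> norm (1::'b) = 1" unfolding power2_eq_square by simp
  then show ?thesis by linarith
qed

lemma norm_power_le: "norm (x ^ n) \<le> norm (x :: 'b::{cstar_algebra, monoid_mult}) ^ n"
proof (induction n)
  case (Suc n)
  then show ?case
    using norm_mult_ineq[of x "x ^ n"] mult_left_mono[OF Suc, of "norm x"] by simp
qed (simp add: norm_one_le)

text \<open>The type class admits algebras with \<open>0 = 1\<close>; the unitization of the zero algebra is one.\<close>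

definition cexp :: "'b::{cstar_algebra, monoid_mult} \<Rightarrow> 'b" where
  "cexp x = (\<Sum>n. x ^ n /\<^sub>R fact n)"

lemma norm_cexp_term_le: "norm (x ^ n /\<^sub>R fact n) \<le> norm (x :: 'b::{cstar_algebra, monoid_mult}) ^ n /\<^sub>R fact n"
  using norm_power_le[of x n] by (simp add: divide_right_mono field_simps)

lemma summable_norm_cexp: "summable (\<lambda>n. norm (x ^ n /\<^sub>R fact n :: 'b::{cstar_algebra, monoid_mult}))"
  by (rule summable_comparison_test'[OF summable_exp_generic[of "norm x"], of 0])
    (use norm_cexp_term_le in \<open>simp only: real_norm_def abs_norm_cancel\<close>)

lemmas summable_cexp = summable_norm_cancel[OF summable_norm_cexp]

lemma cexp_sums: "(\<lambda>n. x ^ n /\<^sub>R fact n) sums cexp x"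
  unfolding cexp_def by (rule summable_sums[OF summable_cexp])

lemma cexp_zero: "cexp 0 = (1 :: 'b::{cstar_algebra, monoid_mult})"
proof -
  have z: "(0::'b) ^ n = (if n = 0 then 1 else 0)" for n by (cases n) auto
  have "(\<lambda>n. (0::'b) ^ n /\<^sub>R fact n) sums (\<Sum>n\<in>{0}. (0::'b) ^ n /\<^sub>R fact n)"
    by (rule sums_finite) (auto simp: z)
  then show ?thesis using cexp_sums[of "0::'b"] by (simp add: sums_unique2)
qed

text \<open>The binomial theorem in the normalisation that makes the series of \<open>x + y\<close> the Cauchy product of
the series of \<open>x\<close> and of \<open>y\<close>.\<close>

lemma cexp_term_add:
  fixes x y :: "'b::{cstar_algebra, monoid_mult}"
  assumes "x * y = y * x"
  shows "(x + y) ^ n /\<^sub>R fact n = (\<Sum>i\<le>n. (x ^ i /\<^sub>R fact i) * (y ^ (n - i) /\<^sub>R fact (n - i)))"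
proof (induction n)
  case (Suc n)
  define S where "S z k = z ^ k /\<^sub>R fact k" for z :: 'b and k :: nat
  have times_S: "z * S z k = real (Suc k) *\<^sub>R S z (Suc k)" for z k
    by (simp add: S_def field_simps del: of_nat_Suc)
  have comm: "y * S x k = S x k * y" for k
  proof -
    have "y * x ^ k = x ^ k * y"
    proof (induction k)
      case (Suc k)
      have "y * x ^ Suc k = x * (y * x ^ k)" using assms by (simp flip: mult.assoc)
      then show ?case by (simp add: Suc mult.assoc)
    qed simp
    then show ?thesis by (simp add: S_def)
  qed
  have IH: "S (x + y) n = (\<Sum>i\<le>n. S x i * S y (n - i))"
    using Suc by (simp add: S_def)
  have "real (Suc n) *\<^sub>R S (x + y) (Suc n) = (x + y) * (\<Sum>i\<le>n. S x i * S y (n - i))"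
    by (simp only: times_S IH[symmetric])
  also have "\<dots> = (\<Sum>i\<le>n. x * S x i * S y (n - i)) + (\<Sum>i\<le>n. S x i * (y * S y (n - i)))"
    by (simp add: distrib_right sum_distrib_left comm sum.distrib flip: mult.assoc)
  also have "(\<Sum>i\<le>n. x * S x i * S y (n - i)) = (\<Sum>i\<le>n. real (Suc i) *\<^sub>R (S x (Suc i) * S y (Suc n - Suc i)))"
    by (simp add: times_S del: of_nat_Suc)
  also have "\<dots> = (\<Sum>i\<le>Suc n. real i *\<^sub>R (S x i * S y (Suc n - i)))"
    by (subst sum.atMost_Suc_shift) simp
  also have "(\<Sum>i\<le>n. S x i * (y * S y (n - i))) = (\<Sum>i\<le>n. real (Suc n - i) *\<^sub>R (S x i * S y (Suc n - i)))"
    by (rule sum.cong) (simp_all add: times_S Suc_diff_le del: of_nat_Suc)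
  also have "\<dots> = (\<Sum>i\<le>Suc n. real (Suc n - i) *\<^sub>R (S x i * S y (Suc n - i)))" by simp
  also have "(\<Sum>i\<le>Suc n. real i *\<^sub>R (S x i * S y (Suc n - i))) + \<dots>
      = real (Suc n) *\<^sub>R (\<Sum>i\<le>Suc n. S x i * S y (Suc n - i))"
    unfolding sum.distrib[symmetric] scaleR_sum_right
    by (intro sum.cong) (simp_all add: of_nat_diff flip: scaleR_add_left)
  finally have "S (x + y) (Suc n) = (\<Sum>i\<le>Suc n. S x i * S y (Suc n - i))"
    by (simp del: of_nat_Suc sum.atMost_Suc)
  then show ?case by (simp add: S_def)
qed simp

lemma cexp_add:
  fixes x y :: "'b::{cstar_algebra, monoid_mult}"
  assumes "x * y = y * x"
  shows "cexp (x + y) = cexp x * cexp y"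
  unfolding cexp_def cexp_term_add[OF assms]
  by (rule Cauchy_product[OF summable_norm_cexp summable_norm_cexp, symmetric])

lemma cexp_scaleR_add: "cexp ((s + t) *\<^sub>R x) = cexp (s *\<^sub>R x) * cexp (t *\<^sub>R x)"
  unfolding scaleR_add_left by (rule cexp_add) (simp add: mult.commute)

lemma cexp_power: "cexp (real n *\<^sub>R x) = cexp x ^ n"
proof (induction n)
  case (Suc n)
  have "cexp (real (Suc n) *\<^sub>R x) = cexp ((1 + real n) *\<^sub>R x)" by simp
  then show ?case unfolding cexp_scaleR_add using Suc by simp
qed (simp add: cexp_zero)

lemma cexp_linear_approx:
  fixes x :: "'b::{cstar_algebra, monoid_mult}"
  assumes "norm x \<le> 1"
  shows "norm (cexp x - 1 - x) \<le> (norm x)\<^sup>2"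
proof -
  have "(\<lambda>n. x ^ (n + 2) /\<^sub>R fact (n + 2)) sums (cexp x - (\<Sum>n<2. x ^ n /\<^sub>R fact n))"
    using cexp_sums by (rule sums_split_initial_segment)
  then have s: "(\<lambda>n. x ^ (n + 2) /\<^sub>R fact (n + 2)) sums (cexp x - 1 - x)"
    by (simp add: numeral_2_eq_2 algebra_simps)
  have "(\<lambda>n. norm x ^ n /\<^sub>R fact n) sums exp (norm x)" by (rule exp_converges)
  then have "(\<lambda>n. norm x ^ (n + 2) /\<^sub>R fact (n + 2)) sums (exp (norm x) - (\<Sum>n<2. norm x ^ n /\<^sub>R fact n))"
    by (rule sums_split_initial_segment)
  then have r: "(\<lambda>n. norm x ^ (n + 2) /\<^sub>R fact (n + 2)) sums (exp (norm x) - 1 - norm x)"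
    by (simp add: numeral_2_eq_2 algebra_simps)
  have "norm (cexp x - 1 - x) \<le> exp (norm x) - 1 - norm x"
    using norm_suminf_le[OF norm_cexp_term_le sums_summable[OF r]]
    unfolding sums_unique[OF r] sums_unique[OF s] .
  also have "\<dots> \<le> (norm x)\<^sup>2" using exp_bound[of "norm x"] assms by simp
  finally show ?thesis .
qed

lemma bounded_linear_adj: "bounded_linear (adj :: 'b::cstar_algebra \<Rightarrow> 'b)"
  by (rule bounded_linear_intro[of _ 1])
    (simp_all add: adj_add norm_adj scaleR_scaleC adj_scaleC)

lemma adj_scaleR: "adj (r *\<^sub>R x) = r *\<^sub>R adj (x::'b::cstar_algebra)"
  by (simp add: scaleR_scaleC adj_scaleC)

lemma adj_minus: "adj (- x) = - adj (x::'b::cstar_algebra)"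
  by (rule linear_neg[OF bounded_linear.linear[OF bounded_linear_adj]])

lemma adj_diff: "adj (x - y) = adj x - adj (y::'b::cstar_algebra)"
  by (rule linear_diff[OF bounded_linear.linear[OF bounded_linear_adj]])

lemma adj_power: "adj (x ^ n) = adj (x::'b::{cstar_algebra,monoid_mult}) ^ n"
  by (induction n) (simp_all add: adj_one adj_mult power_commutes)

lemma adj_cexp: "adj (cexp x) = cexp (adj x)"
proof -
  have "(\<lambda>n. adj (x ^ n /\<^sub>R fact n)) sums adj (cexp x)"
    by (rule bounded_linear.sums[OF bounded_linear_adj cexp_sums])
  then have "(\<lambda>n. adj x ^ n /\<^sub>R fact n) sums adj (cexp x)"
    by (simp add: adj_scaleR adj_power)
  then show ?thesis using cexp_sums sums_unique2 by blast
qed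

lemma unitary_cexp:
  assumes "adj x = - x" shows "unitary (cexp x)"
proof -
  have "cexp (- x) * cexp x = cexp (- x + x)" "cexp x * cexp (- x) = cexp (x + - x)"
    by (simp_all only: cexp_add[of "- x" x] cexp_add[of x "- x"] mult_minus_left mult_minus_right)
  then show ?thesis by (simp add: unitary_def adj_cexp assms cexp_zero)
qed

lemma unitary_mult: "unitary u \<Longrightarrow> unitary v \<Longrightarrow> unitary (u * v)"
proof -
  assume uv: "unitary u" "unitary v"
  have "adj (u * v) * (u * v) = adj v * (adj u * u) * v" "u * v * adj (u * v) = u * (v * adj v) * adj u"
    by (simp_all add: adj_mult mult.assoc)
  then show ?thesis using uv by (simp add: unitary_def)
qed

lemma unitary_power: "unitary u \<Longrightarrow> unitary (u ^ n)"
  by (induction n) (simp_all add: unitary_mult, simp add: unitary_def adj_one)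

lemma unitary_adj: "unitary u \<Longrightarrow> unitary (adj u)"
  by (simp add: unitary_def adj_adj)

lemma unitary_norm_le: "unitary u \<Longrightarrow> norm (u::'b::{cstar_algebra,monoid_mult}) \<le> 1"
  by (rule power2_le_imp_le) (simp_all add: unitary_def norm_one_le flip: cstar_identity)

lemma norm_unitary_mult_left:
  assumes "unitary u" shows "norm (u * x) = norm (x::'b::{cstar_algebra,monoid_mult})"
proof -
  have le: "norm (v * z) \<le> norm z" if "unitary v" for v z :: 'b
    using norm_mult_ineq[of v z] mult_right_mono[OF unitary_norm_le[OF that], of "norm z"] by simp
  have "norm x = norm (adj u * (u * x))" using assms by (simp add: unitary_def flip: mult.assoc)
  then show ?thesis using le[OF unitary_adj[OF assms], of "u * x"] le[OF assms, of x] by simp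
qed

lemma norm_unitary_mult_right:
  assumes "unitary u" shows "norm (x * u) = norm (x::'b::{cstar_algebra,monoid_mult})"
proof -
  have "norm (x * u) = norm (adj u * adj x)" using norm_adj[of "x * u"] by (simp add: adj_mult)
  then show ?thesis by (simp add: norm_unitary_mult_left unitary_adj assms norm_adj)
qed

lemma conj_power:
  assumes "unitary u" shows "(u * x * adj u) ^ n = u * x ^ n * adj u"
proof (induction n)
  case (Suc n)
  have "adj u * (u * z) = z" for z using assms by (simp add: unitary_def flip: mult.assoc)
  then show ?case by (simp only: power_Suc Suc) (simp add: mult.assoc)
qed (use assms in \<open>simp add: unitary_def\<close>)

lemma cexp_conj:
  assumes "unitary u" shows "cexp (u * x * adj u) = u * cexp x * adj u"
proof -
  have "(\<lambda>n. u * (x ^ n /\<^sub>R fact n) * adj u) sums (u * cexp x * adj u)"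
    by (intro sums_mult sums_mult2 cexp_sums)
  then have "(\<lambda>n. (u * x * adj u) ^ n /\<^sub>R fact n) sums (u * cexp x * adj u)"
    by (simp add: conj_power[OF assms])
  then show ?thesis using cexp_sums sums_unique2 by blast
qed

lemma cexp_minus_one_in_ideal:
  assumes J: "closed_ideal J" and "x \<in> J" shows "cexp x - 1 \<in> J"
proof -
  have pow: "x ^ Suc n \<in> J" for n
    using assms by (induction n) (auto simp: closed_ideal_def)
  have "(\<lambda>n. x ^ (n + 1) /\<^sub>R fact (n + 1)) sums (cexp x - (\<Sum>n<1. x ^ n /\<^sub>R fact n))"
    using cexp_sums by (rule sums_split_initial_segment)
  then have lim: "(\<lambda>n. \<Sum>i<n. x ^ Suc i /\<^sub>R fact (Suc i)) \<longlonglongrightarrow> cexp x - 1"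
    by (simp add: sums_def)
  have "(\<Sum>i<n. x ^ Suc i /\<^sub>R fact (Suc i)) \<in> J" for n
    using J pow unfolding closed_ideal_def scaleR_scaleC
    by (intro complex_vector.subspace_sum complex_vector.subspace_scale) auto
  then show ?thesis using J closed_sequentially[OF _ _ lim] by (simp add: closed_ideal_def)
qed

text \<open>Replacing the factors one at a time costs \<open>norm (u - v)\<close> each, since multiplication by a unitary
is isometric. Continuity of the exponential on skew-adjoint elements and the Lie--Trotter formula follow from
this estimate and from the quadratic error of \<open>1 + x\<close>.\<close>

lemma norm_unitary_power_diff_le:
  assumes "unitary u" "unitary v"
  shows "norm (u ^ n - v ^ n) \<le> real n * norm (u - v :: 'b::{cstar_algebra,monoid_mult})"
proof (induction n)
  case (Suc n)
  have "u ^ Suc n - v ^ Suc n = u * (u ^ n - v ^ n) + (u - v) * v ^ n"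
    by (simp add: algebra_simps)
  then have "norm (u ^ Suc n - v ^ Suc n) \<le> norm (u * (u ^ n - v ^ n)) + norm ((u - v) * v ^ n)"
    by (simp only: norm_triangle_ineq)
  also have "\<dots> = norm (u ^ n - v ^ n) + norm (u - v)"
    using assms by (simp add: norm_unitary_mult_left norm_unitary_mult_right unitary_power)
  finally show ?case using Suc by (simp add: algebra_simps)
qed simp

text \<open>Both factors and \<open>cexp ((x + y) / n)\<close> agree with their linearisations up to \<open>O(1/n\<^sup>2)\<close>, so the
\<open>n\<close>-th powers differ by \<open>O(1/n)\<close>.\<close>

lemma cexp_trotter:
  fixes x y :: "'b::{cstar_algebra,monoid_mult}"
  assumes "adj x = - x" "adj y = - y"
  shows "(\<lambda>n. (cexp (x /\<^sub>R real n) * cexp (y /\<^sub>R real n)) ^ n) \<longlonglongrightarrow> cexp (x + y)"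
proof (rule LIM_zero_cancel, rule Lim_null_comparison)
  define M where "M = 1 + norm x + norm y"
  have M: "M > 0" "norm x \<le> M" "norm y \<le> M" "norm (x + y) \<le> M"
    using norm_triangle_ineq[of x y] by (auto simp: M_def add_pos_nonneg)
  show "(\<lambda>n. 5 * M\<^sup>2 / real n) \<longlonglongrightarrow> 0" by (rule lim_const_over_n)
  show "\<forall>\<^sub>F n in sequentially. norm ((cexp (x /\<^sub>R real n) * cexp (y /\<^sub>R real n)) ^ n - cexp (x + y))
      \<le> 5 * M\<^sup>2 / real n"
  proof (rule eventually_sequentiallyI)
    fix n assume n: "n \<ge> max 1 (nat \<lceil>M\<rceil>)"
    then have n0: "real n > 0" and "M \<le> real n" by linarith+
    define m where "m = M / real n"
    have m: "0 < m" "m \<le> 1" using M n0 \<open>M \<le> real n\<close> by (auto simp: m_def)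
    define a b where "a = x /\<^sub>R real n" and "b = y /\<^sub>R real n"
    have ab: "norm a \<le> m" "norm b \<le> m" "norm (a + b) \<le> m"
      using M n0 by (simp_all add: a_def b_def m_def divide_right_mono flip: scaleR_add_right)
         (simp_all add: field_simps)
    have app: "norm (cexp z - 1 - z) \<le> m\<^sup>2" if "norm z \<le> m" for z :: 'b
      using order_trans[OF cexp_linear_approx power_mono[OF that]] that m by simp
    have sk: "adj a = - a" "adj b = - b" "adj (a + b) = - (a + b)"
      by (simp_all add: a_def b_def adj_add adj_scaleR assms)
    have eq: "cexp a * cexp b - cexp (a + b) = cexp a * (cexp b - 1 - b) + (cexp a - 1 - a) * (1 + b)
        + a * b - (cexp (a + b) - 1 - (a + b))"
      by (simp add: algebra_simps)
    have "norm (cexp a * (cexp b - 1 - b)) \<le> m\<^sup>2"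
      using app[OF ab(2)] by (simp add: norm_unitary_mult_left unitary_cexp sk)
    moreover have "norm ((cexp a - 1 - a) * (1 + b)) \<le> m\<^sup>2 * 2"
    proof -
      have "norm (1 + b) \<le> 2"
        using norm_triangle_ineq[of 1 b] norm_one_le[where ?'b='b] ab m by linarith
      then show ?thesis using app[OF ab(1)]
        by (intro order_trans[OF norm_mult_ineq] mult_mono) auto
    qed
    moreover have "norm (a * b) \<le> m\<^sup>2" unfolding power2_eq_square
      using ab m by (intro order_trans[OF norm_mult_ineq] mult_mono) auto
    moreover have tri: "norm (p + q + r - s) \<le> norm p + norm q + norm r + norm s" for p q r s :: 'b
      using norm_triangle_ineq4[of "p + q + r" s] norm_triangle_ineq[of "p + q" r] norm_triangle_ineq[of p q]
      by linarith
    ultimately have "norm (cexp a * cexp b - cexp (a + b)) \<le> 5 * m\<^sup>2"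
      unfolding eq using app[OF ab(3)]
        tri[of "cexp a * (cexp b - 1 - b)" "(cexp a - 1 - a) * (1 + b)" "a * b" "cexp (a + b) - 1 - (a + b)"]
      by linarith
    then have "norm ((cexp a * cexp b) ^ n - cexp (a + b) ^ n) \<le> real n * (5 * m\<^sup>2)"
      by (intro order_trans[OF norm_unitary_power_diff_le] mult_left_mono unitary_mult unitary_cexp sk) auto
    also have "cexp (a + b) ^ n = cexp (x + y)"
      using n0 by (simp add: a_def b_def flip: cexp_power scaleR_add_right)
    also have "real n * (5 * m\<^sup>2) = 5 * M\<^sup>2 / real n"
      using n0 by (simp add: m_def field_simps power2_eq_square)
    finally show "norm ((cexp (x /\<^sub>R real n) * cexp (y /\<^sub>R real n)) ^ n - cexp (x + y)) \<le> 5 * M\<^sup>2 / real n"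
      by (simp add: a_def b_def)
  qed
qed

text \<open>For \<open>x\<close> and \<open>y\<close> divided by \<open>n\<close> the bound holds up to \<open>O(1/n\<^sup>2)\<close>; raising to the \<open>n\<close>-th power
multiplies everything by at most \<open>n\<close>.\<close>

lemma cexp_lipschitz:
  fixes x y :: "'b::{cstar_algebra,monoid_mult}"
  assumes "adj x = - x" "adj y = - y"
  shows "norm (cexp x - cexp y) \<le> norm (x - y)"
proof (rule LIMSEQ_le_const)
  have *: "norm (cexp z - cexp w) \<le> norm (z - w) + (norm z)\<^sup>2 + (norm w)\<^sup>2"
    if "norm z \<le> 1" "norm w \<le> 1" for z w :: 'b
  proof -
    have "cexp z - cexp w = (z - w) + (cexp z - 1 - z) - (cexp w - 1 - w)" by simp
    then have "norm (cexp z - cexp w) \<le> norm (z - w) + norm (cexp z - 1 - z) + norm (cexp w - 1 - w)"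
      by (simp only:) (intro norm_triangle_le_diff norm_triangle_le order.refl add_mono)
    then show ?thesis using cexp_linear_approx[OF that(1)] cexp_linear_approx[OF that(2)] by linarith
  qed
  show "(\<lambda>n. norm (x - y) + ((norm x)\<^sup>2 + (norm y)\<^sup>2) / real n) \<longlonglongrightarrow> norm (x - y)"
    using tendsto_add[OF tendsto_const lim_const_over_n, of "norm (x - y)" "(norm x)\<^sup>2 + (norm y)\<^sup>2"] by simp
  have "norm (cexp x - cexp y) \<le> norm (x - y) + ((norm x)\<^sup>2 + (norm y)\<^sup>2) / real n"
    if n: "n \<ge> max 1 (nat \<lceil>norm x + norm y\<rceil>)" for n
  proof -
    have n0: "real n > 0" using n by linarith
    have "norm x + norm y \<le> real n" using n by linarith
    then have le: "norm x \<le> real n" "norm y \<le> real n" using norm_ge_zero[of x] norm_ge_zero[of y] by linarith+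
    have sk: "adj (x /\<^sub>R real n) = - (x /\<^sub>R real n)" "adj (y /\<^sub>R real n) = - (y /\<^sub>R real n)"
      by (simp_all add: adj_scaleR assms)
    have "norm (cexp x - cexp y) = norm (cexp (x /\<^sub>R real n) ^ n - cexp (y /\<^sub>R real n) ^ n)"
      using n0 by (simp flip: cexp_power)
    also have "\<dots> \<le> real n * norm (cexp (x /\<^sub>R real n) - cexp (y /\<^sub>R real n))"
      by (intro norm_unitary_power_diff_le unitary_cexp sk)
    also have "\<dots> \<le> real n * (norm (x /\<^sub>R real n - y /\<^sub>R real n) + (norm (x /\<^sub>R real n))\<^sup>2 + (norm (y /\<^sub>R real n))\<^sup>2)"
      using n0 le by (intro mult_left_mono *) (simp_all add: field_simps)
    also have "\<dots> = norm (x - y) + ((norm x)\<^sup>2 + (norm y)\<^sup>2) / real n"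
      using n0 by (simp flip: scaleR_diff_right) (simp add: field_simps power2_eq_square)
    finally show ?thesis .
  qed
  then show "\<exists>N. \<forall>n\<ge>N. norm (cexp x - cexp y) \<le> norm (x - y) + ((norm x)\<^sup>2 + (norm y)\<^sup>2) / real n" by blast
qed

lemma cexp_difference_quotient:
  "(\<lambda>n. real (Suc n) *\<^sub>R (cexp (a /\<^sub>R real (Suc n)) - 1)) \<longlonglongrightarrow> a"
proof (rule LIM_zero_cancel, rule Lim_null_comparison)
  show "(\<lambda>n. (norm a)\<^sup>2 / real (Suc n)) \<longlonglongrightarrow> 0" by (rule LIMSEQ_Suc[OF lim_const_over_n])
  show "\<forall>\<^sub>F n in sequentially.
      norm (real (Suc n) *\<^sub>R (cexp (a /\<^sub>R real (Suc n)) - 1) - a) \<le> (norm a)\<^sup>2 / real (Suc n)"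
  proof (rule eventually_sequentiallyI)
    fix n assume n: "n \<ge> nat \<lceil>norm a\<rceil>"
    define r where "r = real (Suc n)"
    have r: "r > 0" "norm a \<le> r" using n unfolding r_def by linarith+
    define b where "b = a /\<^sub>R r"
    have nb: "norm b = norm a / r" using r by (simp add: b_def divide_inverse mult.commute)
    have "r *\<^sub>R (cexp b - 1) - a = r *\<^sub>R (cexp b - 1 - b)"
      using r by (simp add: b_def scaleR_diff_right)
    then have "norm (r *\<^sub>R (cexp b - 1) - a) = r * norm (cexp b - 1 - b)" using r by simp
    also have "\<dots> \<le> r * (norm b)\<^sup>2"
      using r nb by (intro mult_left_mono cexp_linear_approx) simp_all
    also have "\<dots> = (norm a)\<^sup>2 / r" using r by (simp add: nb power2_eq_square)
    finally show "norm (real (Suc n) *\<^sub>R (cexp (a /\<^sub>R real (Suc n)) - 1) - a) \<le> (norm a)\<^sup>2 / real (Suc n)"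
      by (simp only: b_def r_def)
  qed
qed

text \<open>The derivative at \<open>0\<close> of conjugation by \<open>exp (t a)\<close> is the commutator with \<open>a\<close>.\<close>

lemma conj_difference_quotient:
  fixes a h :: "'b::{cstar_algebra, monoid_mult}"
  assumes a: "adj a = - a"
  defines "e \<equiv> \<lambda>n. cexp (a /\<^sub>R real (Suc n))"
  shows "(\<lambda>n. real (Suc n) *\<^sub>R (e n * h * adj (e n) - h)) \<longlonglongrightarrow> a * h - h * a"
proof -
  define X where "X n = real (Suc n) *\<^sub>R (e n - 1)" for n
  have X: "X \<longlonglongrightarrow> a" unfolding X_def e_def by (rule cexp_difference_quotient)
  have sk: "adj (a /\<^sub>R r) = - (a /\<^sub>R r)" for r by (simp add: adj_scaleR a)
  have "(\<lambda>n. inverse (real (Suc n)) *\<^sub>R X n + 1) \<longlonglongrightarrow> 0 *\<^sub>R a + 1"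
    by (intro tendsto_add tendsto_scaleR X tendsto_const LIMSEQ_inverse_real_of_nat)
  then have "e \<longlonglongrightarrow> 1" by (simp add: X_def del: of_nat_Suc)
  then have "(\<lambda>n. adj (e n)) \<longlonglongrightarrow> 1"
    using bounded_linear.tendsto[OF bounded_linear_adj] by (fastforce simp: adj_one)
  then have "(\<lambda>n. (X n * h - h * X n) * adj (e n)) \<longlonglongrightarrow> (a * h - h * a) * 1"
    by (intro tendsto_mult tendsto_diff X tendsto_const)
  moreover have "(X n * h - h * X n) * adj (e n) = real (Suc n) *\<^sub>R (e n * h * adj (e n) - h)" for n
  proof -
    have "e n * adj (e n) = 1" using unitary_cexp[OF sk] by (simp add: e_def unitary_def)
    then have "(e n * h - h * e n) * adj (e n) = e n * h * adj (e n) - h"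
      by (simp add: left_diff_distrib mult.assoc)
    moreover have "X n * h - h * X n = real (Suc n) *\<^sub>R (e n * h - h * e n)"
      by (simp add: X_def algebra_simps scaleR_diff_right del: of_nat_Suc)
    ultimately show ?thesis by (simp del: of_nat_Suc)
  qed
  ultimately show ?thesis by simp
qed

section \<open>Ergodic averages and semiprimeness of closed ideals\<close>

lemma closed_ideal_left: "closed_ideal J \<Longrightarrow> x \<in> J \<Longrightarrow> a * x \<in> J"
  and closed_ideal_right: "closed_ideal J \<Longrightarrow> x \<in> J \<Longrightarrow> x * a \<in> J"
  and closed_ideal_subspace: "closed_ideal J \<Longrightarrow> complex_vector.subspace J"
  and closed_ideal_closed: "closed_ideal J \<Longrightarrow> closed J"
  by (simp_all add: closed_ideal_def)

lemmas closed_ideal_add = complex_vector.subspace_add[OF closed_ideal_subspace]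
lemmas closed_ideal_diff = complex_vector.subspace_diff[OF closed_ideal_subspace]
lemmas closed_ideal_scale = complex_vector.subspace_scale[OF closed_ideal_subspace]

lemma closed_ideal_scaleR: "closed_ideal J \<Longrightarrow> x \<in> J \<Longrightarrow> r *\<^sub>R x \<in> J"
  unfolding scaleR_scaleC by (rule closed_ideal_scale)

lemma closed_ideal_hull: "closed_ideal (closed_ideal hull S)"
  by (rule hull_in) (auto simp: closed_ideal_def complex_vector.subspace_Inter)

text \<open>A mean ergodic theorem: conjugation by \<open>h\<close> is an isometry, so the average of \<open>h\<^sup>k a h\<^sup>-\<^sup>k\<close> over
\<open>k \<le> n\<close> is moved by it only by \<open>O(1/n)\<close>. Here \<open>c n\<close> is \<open>a\<close> minus this average, written as an average of terms
\<open>a - h\<^sup>k a h\<^sup>-\<^sup>k\<close>, each of which lies in any ideal that contains the commutators of \<open>a\<close> with powers of \<open>h\<close>.\<close>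

lemma conj_diff_ergodic_limit:
  fixes h a :: "'b::{cstar_algebra, monoid_mult}"
  assumes h: "unitary h"
  defines "c \<equiv> \<lambda>n. (\<Sum>k<Suc n. a - h ^ k * a * adj (h ^ k)) /\<^sub>R real (Suc n)"
  shows "(\<lambda>n. h * c n * adj h - c n) \<longlonglongrightarrow> h * a * adj h - a"
proof (rule LIM_zero_cancel, rule Lim_null_comparison)
  show "(\<lambda>n. 2 * norm a / real (Suc n)) \<longlonglongrightarrow> 0"
    by (rule LIMSEQ_Suc[OF lim_const_over_n])
  have "norm ((h * c n * adj h - c n) - (h * a * adj h - a)) \<le> 2 * norm a / real (Suc n)" for n
  proof -
    define b where "b k = h ^ k * a * adj (h ^ k)" for k
    have hb: "h * b k * adj h = b (Suc k)" for k
      by (simp add: b_def adj_mult mult.assoc)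
    have "h * (\<Sum>k<m. a - b k) * adj h - (\<Sum>k<m. a - b k) = real m *\<^sub>R (h * a * adj h - a) - (b m - b 0)" for m
    proof (induction m)
      case (Suc m)
      have "h * (\<Sum>k<Suc m. a - b k) * adj h - (\<Sum>k<Suc m. a - b k)
        = (h * (\<Sum>k<m. a - b k) * adj h - (\<Sum>k<m. a - b k)) + (h * a * adj h - a) - (h * b m * adj h - b m)"
        by (simp add: algebra_simps)
      then show ?case unfolding Suc hb by (simp add: algebra_simps)
    qed simp
    moreover have scale: "(r *\<^sub>R d - e) /\<^sub>R r - d = - (e /\<^sub>R r)" if "r \<noteq> 0" for r and d e :: 'b
      using that by (simp add: scaleR_diff_right)
    ultimately have "(h * c n * adj h - c n) - (h * a * adj h - a) = - ((b (Suc n) - b 0) /\<^sub>R real (Suc n))"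
      unfolding c_def b_def[symmetric] mult_scaleR_left mult_scaleR_right scaleR_diff_right[symmetric]
      by (simp add: scale del: of_nat_Suc sum.lessThan_Suc)
    then have "norm ((h * c n * adj h - c n) - (h * a * adj h - a)) = norm (b (Suc n) - b 0) / real (Suc n)"
      by (simp add: divide_inverse mult.commute del: of_nat_Suc)
    also have "norm (b k) = norm a" for k
      using h by (simp add: b_def norm_unitary_mult_left norm_unitary_mult_right unitary_power unitary_adj)
    then have "norm (b (Suc n) - b 0) / real (Suc n) \<le> 2 * norm a / real (Suc n)"
      using norm_triangle_ineq4[of "b (Suc n)" "b 0"] by (intro divide_right_mono) auto
    finally show ?thesis .
  qed
  then show "\<forall>\<^sub>F n in sequentially. norm ((h * c n * adj h - c n) - (h * a * adj h - a)) \<le> 2 * norm a / real (Suc n)"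
    by (intro always_eventually allI)
qed

lemma power_sum_telescope: "(u - 1) * (\<Sum>k<n. u ^ k) = u ^ n - (1::'b::{cstar_algebra, monoid_mult})"
  by (induction n) (simp_all add: distrib_left left_diff_distrib)

lemma norm_unitary_power_minus_one: "unitary u \<Longrightarrow> norm (u ^ n - 1) \<le> 2"
  using norm_triangle_ineq4[of "u ^ n" 1] unitary_norm_le[OF unitary_power, of u n]
    norm_one_le[where ?'b='a] by linarith

text \<open>Put \<open>b = y\<^sup>* y \<in> J\<close> and let \<open>f\<close> be a long average of powers of the unitary \<open>u = exp (\<i> b / n)\<close>.
Since \<open>1 - f \<in> J\<close>, it suffices that \<open>y f\<close> is small, and \<open>norm (y f)\<^sup>2 \<le> norm (b f)\<close> when \<open>norm f \<le> 1\<close>. The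
average is almost fixed by \<open>u\<close>, and \<open>u - 1\<close> is almost \<open>\<i> b / n\<close>; so \<open>b f\<close> is small.\<close>

lemma closed_ideal_adj_mult_self:
  fixes J :: "'b::{cstar_algebra, monoid_mult} set"
  assumes J: "closed_ideal J" and y: "adj y * y \<in> J"
  shows "y \<in> J"
proof -
  define b where "b = adj y * y"
  have bJ: "b \<in> J" and ba: "adj b = b" using y by (simp_all add: b_def adj_mult adj_adj)
  define C where "C = 2 + (norm b)\<^sup>2"
  have "C > 0" by (simp add: C_def add_pos_nonneg)
  have "\<exists>x\<in>J. dist x y < e" if "e > 0" for e
  proof -
    have "e\<^sup>2 > 0" using that by simp
    \<comment> \<open>The step \<open>1/n\<close> of the unitary group and the length \<open>n\<^sup>2\<close> of the average are chosen such that both errors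
      in the estimate of \<open>b f\<close>, namely \<open>2 / n\<close> and \<open>(norm b)\<^sup>2 / n\<close>, tend to \<open>0\<close>.\<close>
    obtain n :: nat where n: "norm b + C / e\<^sup>2 < real n" using reals_Archimedean2 by blast
    have "C / e\<^sup>2 > 0" using \<open>C > 0\<close> \<open>e\<^sup>2 > 0\<close> by simp
    then have nb: "norm b \<le> real n" and n0: "real n > 0" and "C / e\<^sup>2 < real n"
      using n norm_ge_zero[of b] by linarith+
    then have Ce: "C / real n < e\<^sup>2" using \<open>e\<^sup>2 > 0\<close> by (simp add: field_simps)
    define z where "z = (\<i> / of_nat n) *\<^sub>C b"
    have z: "adj z = - z" "z \<in> J"
      using J bJ closed_ideal_scale by (auto simp: z_def adj_scaleC ba)
    have nz: "norm z = norm b / real n" by (simp add: z_def norm_scaleC norm_divide)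
    have bz: "b = (- \<i> * of_nat n) *\<^sub>C z" using n0 by (simp add: z_def scaleC_scaleC scaleC_one)
    define u where "u = cexp z"
    have u: "unitary u" unfolding u_def by (rule unitary_cexp[OF z(1)])
    define f where "f = (\<Sum>k<n\<^sup>2. u ^ k) /\<^sub>R real (n\<^sup>2)"
    have "norm (\<Sum>k<n\<^sup>2. u ^ k) \<le> real (n\<^sup>2)"
      using sum_norm_bound[of "{..<n\<^sup>2}" "\<lambda>k. u ^ k" 1] unitary_norm_le[OF unitary_power[OF u]] by simp
    then have f1: "norm f \<le> 1" using n0 by (simp add: f_def field_simps)
    have "(\<Sum>k<n\<^sup>2. u ^ k - 1) \<in> J"
      unfolding u_def cexp_power[symmetric]
      by (intro complex_vector.subspace_sum closed_ideal_subspace cexp_minus_one_in_ideal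
          closed_ideal_scaleR J z)
    moreover have "1 - f = - ((\<Sum>k<n\<^sup>2. u ^ k - 1) /\<^sub>R real (n\<^sup>2))"
    proof -
      have "(\<Sum>k<n\<^sup>2. (1::'b)) = real (n\<^sup>2) *\<^sub>R 1"
        by (induction "n\<^sup>2") (simp_all add: sum_constant_scaleR)
      then show ?thesis using n0 by (simp add: f_def sum_subtractf scaleR_diff_right)
    qed
    ultimately have "1 - f \<in> J"
      using J by (simp only:) (intro complex_vector.subspace_neg closed_ideal_subspace closed_ideal_scaleR)
    then have "y * (1 - f) \<in> J" by (rule closed_ideal_left[OF J])
    moreover have "dist (y * (1 - f)) y = norm (y * f)"
      by (simp add: dist_norm right_diff_distrib)
    moreover have "norm (y * f) < e"
    proof -
      have "norm ((u - 1) * f) = norm (u ^ n\<^sup>2 - 1) / real (n\<^sup>2)"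
        by (simp add: f_def power_sum_telescope divide_inverse mult.commute)
      also have "\<dots> \<le> 2 / real (n\<^sup>2)"
        using norm_unitary_power_minus_one[OF u] by (intro divide_right_mono) auto
      finally have 1: "norm ((u - 1) * f) \<le> 2 / real (n\<^sup>2)" .
      have "norm ((u - 1 - z) * f) \<le> (norm z)\<^sup>2 * 1"
        unfolding u_def using nb n0 f1
        by (intro order_trans[OF norm_mult_ineq] mult_mono cexp_linear_approx) (simp_all add: nz)
      then have 2: "norm ((u - 1 - z) * f) \<le> (norm b)\<^sup>2 / real (n\<^sup>2)"
        by (simp add: nz power_divide)
      have "z * f = (u - 1) * f - (u - 1 - z) * f" by (simp add: algebra_simps)
      then have "norm (z * f) \<le> C / real (n\<^sup>2)"
        using norm_triangle_ineq4[of "(u - 1) * f" "(u - 1 - z) * f"] 1 2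
        by (simp only: C_def add_divide_distrib)
      then have "real n * norm (z * f) \<le> real n * (C / real (n\<^sup>2))" by (intro mult_left_mono) auto
      also have "real n * (C / real (n\<^sup>2)) = C / real n" using n0 by (simp add: field_simps power2_eq_square)
      also have "real n * norm (z * f) = norm (b * f)"
        by (simp add: bz mult_scaleC_left norm_scaleC norm_mult)
      finally have bf: "norm (b * f) < e\<^sup>2" using Ce by linarith
      have "(norm (y * f))\<^sup>2 = norm (adj f * (b * f))"
        by (simp add: b_def adj_mult mult.assoc flip: cstar_identity)
      also have "\<dots> \<le> norm (adj f) * norm (b * f)" by (rule norm_mult_ineq)
      also have "\<dots> \<le> 1 * norm (b * f)" using f1 by (intro mult_right_mono) (simp_all add: norm_adj)
      finally have "(norm (y * f))\<^sup>2 < e\<^sup>2" using bf by simp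
      then show ?thesis using that by (simp add: power2_less_imp_less)
    qed
    ultimately show ?thesis by metis
  qed
  then have "y \<in> closure J" by (simp add: closure_approachable)
  then show ?thesis using closed_ideal_closed[OF J] by simp
qed

text \<open>The square of \<open>y\<^sup>* y\<close> is \<open>y\<^sup>* (y y\<^sup>* y)\<close>, so two square roots can be taken inside the ideal.\<close>

lemma closed_ideal_semiprime:
  fixes J :: "'b::{cstar_algebra, monoid_mult} set"
  assumes J: "closed_ideal J" and y: "\<And>a. y * a * y \<in> J"
  shows "y \<in> J"
proof -
  have "adj (adj y * y) * (adj y * y) = adj y * (y * adj y * y)"
    by (simp add: adj_mult adj_adj mult.assoc)
  then have "adj (adj y * y) * (adj y * y) \<in> J"
    using closed_ideal_left[OF J y] by simp
  then have "adj y * y \<in> J" by (rule closed_ideal_adj_mult_self[OF J])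
  then show ?thesis by (rule closed_ideal_adj_mult_self[OF J])
qed

section \<open>Lie ideals\<close>

lemma complex_subspace_closure:
  fixes S :: "'b::cstar_algebra set"
  assumes S: "complex_vector.subspace S" shows "complex_vector.subspace (closure S)"
proof (rule complex_vector.subspaceI)
  show "0 \<in> closure S" using complex_vector.subspace_0[OF S] closure_subset by blast
next
  fix x y assume "x \<in> closure S" "y \<in> closure S"
  then obtain f g where "\<And>n. f n \<in> S" "f \<longlonglongrightarrow> x" "\<And>n. g n \<in> S" "g \<longlonglongrightarrow> y"
    by (auto simp: closure_sequential)
  then show "x + y \<in> closure S"
    unfolding closure_sequential
    by (intro exI[of _ "\<lambda>n. f n + g n"]) (auto intro: complex_vector.subspace_add[OF S] tendsto_add)
next
  fix c x assume "x \<in> closure S"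
  then obtain f where "\<And>n. f n \<in> S" "f \<longlonglongrightarrow> x" by (auto simp: closure_sequential)
  then show "c *\<^sub>C x \<in> closure S"
    unfolding closure_sequential
    by (intro exI[of _ "\<lambda>n. c *\<^sub>C f n"])
      (auto intro: complex_vector.subspace_scale[OF S] bounded_linear.tendsto[OF bounded_linear_scaleC])
qed

text \<open>The elements whose commutators with a given set fall into a closed subspace again form a closed
subspace. This and the next lemma extend commutator conditions from a set to its closed linear span.\<close>

lemma closed_commuting_into:
  fixes V :: "'b::cstar_algebra set"
  assumes "closed V" shows "closed {w. \<forall>a\<in>S. w * a - a * w \<in> V}"
proof -
  have "closed (\<Inter>a\<in>S. (\<lambda>w. w * a - a * w) -` V)"
    by (intro closed_INT ballI closed_vimage assms continuous_intros)
  also have "(\<Inter>a\<in>S. (\<lambda>w. w * a - a * w) -` V) = {w. \<forall>a\<in>S. w * a - a * w \<in> V}" by auto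
  finally show ?thesis .
qed

lemma subspace_commuting_into:
  fixes V :: "'b::cstar_algebra set"
  assumes V: "complex_vector.subspace V"
  shows "complex_vector.subspace {w. \<forall>a\<in>S. w * a - a * w \<in> V}" (is "complex_vector.subspace ?W")
proof (rule complex_vector.subspaceI)
  show "0 \<in> ?W" by (simp add: complex_vector.subspace_0[OF V])
next
  fix x y assume "x \<in> ?W" "y \<in> ?W"
  then have "(x * a - a * x) + (y * a - a * y) \<in> V" if "a \<in> S" for a
    using that by (intro complex_vector.subspace_add[OF V]) auto
  then show "x + y \<in> ?W" by (simp add: algebra_simps)
next
  fix c x assume "x \<in> ?W"
  then have "c *\<^sub>C (x * a - a * x) \<in> V" if "a \<in> S" for a
    using that by (intro complex_vector.subspace_scale[OF V]) auto
  then show "c *\<^sub>C x \<in> ?W"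
    by (simp add: mult_scaleC_left mult_scaleC_right complex_vector.scale_right_diff_distrib)
qed

text \<open>Herstein's argument. The derivation \<open>d = [x, \<cdot>]\<close> satisfies \<open>d (d a) \<in> [L, L]\<close>. The Leibniz rule
for \<open>d (d (a b))\<close> then puts \<open>2 d(a) d(b)\<close> into the ideal, and substituting \<open>b a\<close> for \<open>b\<close> gives
\<open>d(a) b d(a)\<close>; semiprimeness finishes the proof.\<close>

lemma commutator_in_lie_hull:
  fixes L :: "'b::{cstar_algebra, monoid_mult} set"
  assumes Lie: "\<And>x a. x \<in> L \<Longrightarrow> x * a - a * x \<in> L" and x: "x \<in> L"
  shows "x * a - a * x \<in> closed_ideal hull {x * y - y * x | x y. x \<in> L \<and> y \<in> L}" (is "_ \<in> ?K")
proof -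
  note K = closed_ideal_hull[of "{x * y - y * x | x y. x \<in> L \<and> y \<in> L}"]
  define d where "d a = x * a - a * x" for a
  have dd: "d (d a) \<in> ?K" for a
  proof (rule hull_inc)
    have "d a \<in> L" unfolding d_def by (rule Lie[OF x])
    then show "d (d a) \<in> {x * y - y * x | x y. x \<in> L \<and> y \<in> L}"
      using x unfolding d_def[of "d a"] by blast
  qed
  have prod: "d a * d b \<in> ?K" for a b
  proof -
    \<comment> \<open>the Leibniz rule applied twice\<close>
    have "2 *\<^sub>R (d a * d b) = d (d (a * b)) - d (d a) * b - a * d (d b)"
      by (simp add: d_def algebra_simps scaleR_2)
    also have "\<dots> \<in> ?K" by (intro closed_ideal_diff[OF K] closed_ideal_left[OF K] closed_ideal_right[OF K] dd)
    finally have "(1 / 2) *\<^sub>R (2 *\<^sub>R (d a * d b)) \<in> ?K" by (rule closed_ideal_scaleR[OF K])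
    then show ?thesis by simp
  qed
  have "d a * b * d a \<in> ?K" for b
  proof -
    have "d a * b * d a = d a * d (b * a) - d a * d b * a" by (simp add: d_def algebra_simps)
    also have "\<dots> \<in> ?K" by (intro closed_ideal_diff[OF K] closed_ideal_right[OF K] prod)
    finally show ?thesis .
  qed
  then have "d a \<in> ?K" by (rule closed_ideal_semiprime[OF K])
  then show ?thesis by (simp add: d_def)
qed

text \<open>The elements \<open>k\<close> with \<open>b k c \<in> W\<close> for all \<open>b\<close>, \<open>c\<close> form a closed ideal. It contains \<open>[x, y]\<close>
for \<open>x, y \<in> L\<close>, because \<open>[x, y] c = [x, y c] - y [x, c]\<close> is in \<open>L + L L\<close>, and moving \<open>b\<close> to the right end
changes it by a commutator with \<open>L + L L\<close>, hence by an element of \<open>L\<close>.\<close>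

lemma lie_hull_subset:
  fixes L W :: "'b::{cstar_algebra, monoid_mult} set"
  assumes L: "complex_vector.subspace L" and Lie: "\<And>x a. x \<in> L \<Longrightarrow> x * a - a * x \<in> L"
    and W: "closed W" "complex_vector.subspace W"
    and LW: "L \<subseteq> W" and LLW: "\<And>x y. x \<in> L \<Longrightarrow> y \<in> L \<Longrightarrow> x * y \<in> W"
  shows "closed_ideal hull {x * y - y * x | x y. x \<in> L \<and> y \<in> L} \<subseteq> W"
proof -
  define K where "K = {k. \<forall>b c. b * k * c \<in> W}"
  have "closed_ideal K"
    unfolding closed_ideal_def
  proof (intro conjI allI ballI)
    have "closed (\<Inter>b c. (\<lambda>k. b * k * c) -` W)"
      by (intro closed_INT ballI closed_vimage W continuous_intros)
    also have "(\<Inter>b c. (\<lambda>k. b * k * c) -` W) = K" by (auto simp: K_def)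
    finally show "closed K" .
    show "complex_vector.subspace K"
      by (rule complex_vector.subspaceI)
        (auto simp: K_def complex_vector.subspace_0[OF W(2)] distrib_left distrib_right
          mult_scaleC_left mult_scaleC_right
          complex_vector.subspace_add[OF W(2)] complex_vector.subspace_scale[OF W(2)])
    fix a k assume k: "k \<in> K"
    have "b * (a * k) * c = (b * a) * k * c" "b * (k * a) * c = b * k * (a * c)" for b c
      by (simp_all add: mult.assoc)
    then show "a * k \<in> K" "k * a \<in> K" using k by (simp_all add: K_def)
  qed
  moreover have "x * y - y * x \<in> K" if x: "x \<in> L" and y: "y \<in> L" for x y
    unfolding K_def
  proof (intro CollectI allI)
    fix b c
    have prod: "b * (p * q) - (p * q) * b \<in> W" if "p \<in> L" "q \<in> L" for p q
    proof -
      have "b * (p * q) - (p * q) * b = - (p * (q * b) - (q * b) * p) - (q * (b * p) - (b * p) * q)"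
        by (simp add: algebra_simps)
      also have "\<dots> \<in> L" using that by (intro complex_vector.subspace_diff[OF L] complex_vector.subspace_neg[OF L] Lie)
      finally show ?thesis using LW by blast
    qed
    have lin: "b * p - p * b \<in> W" if "p \<in> L" for p
      using complex_vector.subspace_neg[OF L Lie[OF that, of b]] LW by auto
    define p where "p c = x * (y * c) - (y * c) * x" for c
    define q where "q c = x * c - c * x" for c
    have pq: "p c \<in> L" "q c \<in> L" for c unfolding p_def q_def by (rule Lie[OF x])+
    have eq: "(x * y - y * x) * c = p c - y * q c" for c by (simp add: p_def q_def algebra_simps)
    \<comment> \<open>\<open>b k = [b, k] + k b\<close> for \<open>k = [x, y] c\<close>\<close>
    have "b * (x * y - y * x) * c
        = (b * p c - p c * b) - (b * (y * q c) - (y * q c) * b) + (p (c * b) - y * q (c * b))"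
      unfolding eq[symmetric] by (simp add: p_def q_def algebra_simps)
    also have "\<dots> \<in> W"
      using pq LW by (intro complex_vector.subspace_add[OF W(2)] complex_vector.subspace_diff[OF W(2)]
          lin prod y LLW) auto
    finally show "b * (x * y - y * x) * c \<in> W" .
  qed
  ultimately have "closed_ideal hull {x * y - y * x | x y. x \<in> L \<and> y \<in> L} \<subseteq> K"
    by (intro hull_minimal) auto
  also have "K \<subseteq> W"
  proof
    fix k assume "k \<in> K"
    then have "1 * k * 1 \<in> W" unfolding K_def by blast
    then show "k \<in> W" by simp
  qed
  finally show ?thesis .
qed

section \<open>Ideals of the unitization\<close>

lemma scal_scaleC: "scal (c *\<^sub>C u) = c * scal u" and part_scaleC: "part (c *\<^sub>C u) = c *\<^sub>C part u"
  and scal_adj: "scal (adj u) = cnj (scal u)" and part_adj: "part (adj u) = adj (part u)"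
  by (transfer, auto)+

lemma emb_scaleC: "emb (c *\<^sub>C x) = c *\<^sub>C emb x" and emb_adj: "emb (adj x) = adj (emb x)"
  and emb_scaleR: "emb (r *\<^sub>R x) = r *\<^sub>R emb x"
  by (simp_all add: unitization_eq_iff scal_scaleC part_scaleC scal_adj part_adj)

lemma emb_mult_right: "emb x * u = emb (scal u *\<^sub>C x + x * part u)"
  and emb_mult_left: "u * emb x = emb (scal u *\<^sub>C x + part u * x)"
  by (simp_all add: unitization_eq_iff)

text \<open>In a unital algebra the scalar part is \<open>0\<close>, and \<open>part 1\<close> is the unit; so the formula holds in
both cases.\<close>

lemma unitization_decomp: "u = scal u *\<^sub>C 1 + emb (part u)"
  by (cases "unital_algebra TYPE('a::cstar_algebra)")
    (simp_all add: unitization_eq_iff scal_scaleC part_scaleC scal_unital scal_one part_one)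

lemma bounded_linear_emb: "bounded_linear emb"
  by (rule bounded_linear_intro[of _ 1]) (simp_all add: emb_algebra emb_scaleR norm_emb)

lemma closed_ideal_image_emb:
  assumes "closed_ideal J" shows "closed_ideal (emb ` J)"
  unfolding closed_ideal_def
proof (intro conjI allI ballI)
  have "complete J" using closed_ideal_closed[OF assms] by (simp add: complete_eq_closed)
  moreover have "subspace J"
    using closed_ideal_subspace[OF assms] by (simp add: subspace_def complex_vector.subspace_def scaleR_scaleC)
  ultimately have "complete (emb ` J)"
    by (intro complete_isometric_image[of 1]) (simp_all add: bounded_linear_emb norm_emb)
  then show "closed (emb ` J)" by (rule complete_imp_closed)
  have sub: "complex_vector.subspace J" by (rule closed_ideal_subspace[OF assms])
  show "complex_vector.subspace (emb ` J)"
    using sub[unfolded complex_vector.subspace_def]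
    by (auto simp: complex_vector.subspace_def emb_algebra emb_scaleC intro!: rev_image_eqI
        simp flip: emb_algebra emb_scaleC)
  fix a x assume "x \<in> emb ` J"
  then obtain y where "y \<in> J" "x = emb y" by blast
  then show "a * x \<in> emb ` J" "x * a \<in> emb ` J"
    unfolding emb_mult_right emb_mult_left
    by (simp_all add: emb_mult_right emb_mult_left imageI closed_ideal_add closed_ideal_scale
        closed_ideal_left closed_ideal_right assms)
qed

lemma closed_ideal_range_emb: "closed_ideal (range emb)"
  by (rule closed_ideal_image_emb[OF closed_ideal_UNIV])

lemma closed_ideal_vimage_emb:
  assumes "closed_ideal K" shows "closed_ideal (emb -` K)"
  unfolding closed_ideal_def
proof (intro conjI allI ballI)
  have "continuous_on UNIV emb"
    by (rule linear_continuous_on[OF bounded_linear_emb])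
  then show "closed (emb -` K)" by (rule closed_vimage[OF closed_ideal_closed[OF assms]])
  show "complex_vector.subspace (emb -` K)"
    using closed_ideal_subspace[OF assms] by (simp add: complex_vector.subspace_def emb_algebra emb_scaleC)
qed (simp_all add: emb_algebra closed_ideal_left[OF assms] closed_ideal_right[OF assms])

lemma skew_part_in_range_emb: "u \<in> unitaries UNIV \<Longrightarrow> u - adj u \<in> range emb"
  by (auto simp: unitaries_def adj_add adj_one simp flip: emb_adj emb_algebra(2))

section \<open>The connected unitary group\<close>

abbreviation UA :: "'a::cstar_algebra unitization set" where "UA \<equiv> unitaries0 UNIV"

lemma UA_unitary: "u \<in> UA \<Longrightarrow> unitary u"
  using unitaries0_subset by (auto simp: unitaries_def)

lemma UA_mult: "u \<in> UA \<Longrightarrow> v \<in> UA \<Longrightarrow> u * v \<in> UA"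
  using unitaries0_translate[OF _ unitaries0_one] unitaries0_subset by auto

lemma UA_adj:
  assumes "u \<in> UA" shows "adj u \<in> UA"
proof -
  have "u \<in> unitaries UNIV" using assms unitaries0_subset by blast
  then show ?thesis
    using unitaries0_translate[OF adj_in_unitaries assms _ unitaries0_one, of u] unitaries0_one UA_unitary[OF assms]
    by (simp add: unitary_def)
qed

lemma UA_inv: "u \<in> UA \<Longrightarrow> inv\<^bsub>unitary_group0\<^esub> u = adj u"
  by (rule group.inv_equality[OF group_unitary_group0])
    (use UA_unitary UA_adj in \<open>auto simp: unitary_group0_def unitary_def\<close>)

lemma cexp_in_unitaries:
  assumes J: "closed_ideal J" and x: "x \<in> emb ` J" "adj x = - x"
  shows "cexp x \<in> unitaries J"
proof -
  have "cexp x - 1 \<in> emb ` J" by (rule cexp_minus_one_in_ideal[OF closed_ideal_image_emb[OF J] x(1)])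
  then obtain y where "y \<in> J" "cexp x - 1 = emb y" by blast
  then have "cexp x = 1 + emb y" by (simp add: algebra_simps)
  then show ?thesis using \<open>y \<in> J\<close> unitary_cexp[OF x(2)] by (auto simp: unitaries_def)
qed

lemma cexp_in_unitaries0:
  assumes J: "closed_ideal J" and x: "x \<in> emb ` J" "adj x = - x"
  shows "cexp x \<in> unitaries0 J"
proof -
  define \<gamma> where "\<gamma> t = cexp (t *\<^sub>R x)" for t :: real
  have sk: "adj (t *\<^sub>R x) = - (t *\<^sub>R x)" for t by (simp add: adj_scaleR x)
  have "continuous_on UNIV \<gamma>"
    unfolding continuous_on_iff
  proof (intro ballI allI impI)
    fix t and e :: real assume "e > 0"
    have "dist (\<gamma> s) (\<gamma> t) < e" if "dist s t < e / (1 + norm x)" for s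
    proof -
      have "dist (\<gamma> s) (\<gamma> t) \<le> norm (s *\<^sub>R x - t *\<^sub>R x)"
        unfolding \<gamma>_def dist_norm by (rule cexp_lipschitz[OF sk sk])
      also have "\<dots> = dist s t * norm x" by (simp add: dist_norm flip: scaleR_diff_left)
      also have "\<dots> \<le> dist s t * (1 + norm x)" by (intro mult_left_mono) auto
      also have "\<dots> < e" using that by (simp add: pos_less_divide_eq add_pos_nonneg)
      finally show ?thesis .
    qed
    moreover have "e / (1 + norm x) > 0" using \<open>e > 0\<close> by (simp add: add_pos_nonneg)
    ultimately show "\<exists>d>0. \<forall>s\<in>UNIV. dist s t < d \<longrightarrow> dist (\<gamma> s) (\<gamma> t) < e" by blast
  qed
  then have "connected (range \<gamma>)" by (rule connected_continuous_image) simp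
  moreover have "range \<gamma> \<subseteq> unitaries J"
    unfolding \<gamma>_def using sk closed_ideal_scaleR[OF closed_ideal_image_emb[OF J] x(1)]
    by (blast intro: cexp_in_unitaries[OF J])
  moreover have "1 \<in> range \<gamma>" by (rule range_eqI[of _ _ 0]) (simp add: \<gamma>_def cexp_zero)
  ultimately have "range \<gamma> \<subseteq> unitaries0 J"
    unfolding unitaries0_def by (intro connected_component_maximal)
  moreover have "cexp x = \<gamma> 1" by (simp add: \<gamma>_def)
  ultimately show ?thesis by blast
qed

lemma unitaries0_conj:
  assumes J: "closed_ideal J" and u: "unitary u" and v: "v \<in> unitaries0 J"
  shows "u * v * adj u \<in> unitaries0 J"
proof -
  let ?T = "(\<lambda>w. u * w * adj u) ` unitaries0 J"
  have uu: "u * adj u = 1" using u by (simp add: unitary_def)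
  have "connected ?T"
    unfolding unitaries0_def
    by (intro connected_continuous_image connected_connected_component continuous_intros)
  moreover have "?T \<subseteq> unitaries J"
  proof
    fix z assume "z \<in> ?T"
    then obtain w where w: "w \<in> unitaries J" "z = u * w * adj u" using unitaries0_subset by blast
    then obtain y where y: "y \<in> J" "w = 1 + emb y" and "unitary w" by (auto simp: unitaries_def)
    have "u * emb y * adj u \<in> emb ` J"
      using y(1) closed_ideal_image_emb[OF J] by (intro closed_ideal_left closed_ideal_right) auto
    then obtain y' where "y' \<in> J" "u * emb y * adj u = emb y'" by blast
    then have "z = 1 + emb y'" by (simp add: w(2) y(2) distrib_left distrib_right uu)
    moreover have "unitary z" unfolding w(2) by (intro unitary_mult u unitary_adj \<open>unitary w\<close>)
    ultimately show "z \<in> unitaries J" using \<open>y' \<in> J\<close> by (auto simp: unitaries_def)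
  qed
  moreover have "1 \<in> ?T"
    by (rule rev_image_eqI[of 1])
      (simp_all add: uu unitaries0_def connected_component_refl unitaries_one[OF J])
  ultimately have "?T \<subseteq> unitaries0 J"
    unfolding unitaries0_def by (intro connected_component_maximal)
  then show ?thesis using v by blast
qed

text \<open>A Newton step for the logarithm: \<open>a\<close> agrees with \<open>w - 1\<close> up to \<open>(w - 1)\<^sup>* (w - 1) / 2\<close>, and
\<open>cexp a\<close> agrees with \<open>1 + a\<close> up to second order.\<close>

lemma norm_cexp_skew_part_le:
  fixes w :: "'b::{cstar_algebra, monoid_mult}"
  assumes w: "unitary w" "norm (w - 1) \<le> 1"
  defines "a \<equiv> (w - adj w) /\<^sub>R 2"
  shows "norm (adj (cexp a) * w - 1) \<le> 3 / 2 * (norm (w - 1))\<^sup>2"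
proof -
  have sk: "adj a = - a" by (simp add: a_def adj_scaleR adj_diff adj_adj flip: scaleR_minus_right)
  have "a = ((w - 1) - adj (w - 1)) /\<^sub>R 2" by (simp add: a_def adj_diff adj_one)
  then have "norm a \<le> norm (w - 1)"
    using norm_triangle_ineq4[of "w - 1" "adj (w - 1)"] by (simp add: norm_adj)
  then have a: "norm (cexp a - 1 - a) \<le> (norm (w - 1))\<^sup>2"
    using order_trans[OF cexp_linear_approx power_mono[of "norm a" "norm (w - 1)" 2]] w(2) by simp
  have ww: "adj w * w = 1" using w by (simp add: unitary_def)
  have "2 *\<^sub>R (w - 1 - a) = - (adj (w - 1) * (w - 1))"
    by (simp add: a_def scaleR_diff_right adj_diff adj_one algebra_simps ww scaleR_2)
  then have "w - 1 - a = - ((adj (w - 1) * (w - 1)) /\<^sub>R 2)"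
    by (metis scaleR_minus_right scaleR_half_double scaleR_scaleR divideR_right zero_neq_numeral)
  then have b: "norm (w - 1 - a) = (norm (w - 1))\<^sup>2 / 2" by (simp add: cstar_identity)
  have "norm (adj (cexp a) * w - 1) = norm (adj (cexp a) * (w - cexp a))"
    using unitary_cexp[OF sk] by (simp add: right_diff_distrib unitary_def)
  also have "\<dots> = norm ((w - 1 - a) - (cexp a - 1 - a))"
    using unitary_cexp[OF sk] by (simp add: norm_unitary_mult_left unitary_adj)
  also have "\<dots> \<le> norm (w - 1 - a) + norm (cexp a - 1 - a)" by (rule norm_triangle_ineq4)
  finally show ?thesis using a b by simp
qed

text \<open>The exponentials of skew-adjoint elements of the algebra generate a dense subgroup of the connected
component. Near \<open>1\<close> a unitary is an infinite product of exponentials, found by iterating the Newton step. So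
the closed, multiplicatively closed set of elements satisfying \<open>P\<close> is also open.\<close>

lemma UA_topological_induct [consumes 1, case_names lim exp prod]:
  assumes u: "u \<in> UA" and P: "closed {u. P u}"
    and cexp: "\<And>a. a \<in> range emb \<Longrightarrow> adj a = - a \<Longrightarrow> P (cexp a)"
    and mult: "\<And>u v. u \<in> UA \<Longrightarrow> v \<in> UA \<Longrightarrow> P u \<Longrightarrow> P v \<Longrightarrow> P (u * v)"
  shows "P u"
proof -
  have near: "P w" if w: "w \<in> UA" "norm (w - 1) \<le> 1 / 2" for w
  proof -
    have appr: "\<exists>p\<in>UA. P p \<and> norm (adj p * w - 1) \<le> (3 / 4) ^ n / 2" for n
    proof (induction n)
      case 0
      \<comment> \<open>\<open>p = 1\<close> satisfies \<open>P\<close> as the exponential of \<open>0\<close>\<close>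
      have "P (cexp 0)" by (rule cexp) (auto simp: adj_zero intro: range_eqI[of _ _ 0] simp: emb_algebra)
      then show ?case using w unitaries0_one by (auto simp: cexp_zero adj_one intro!: bexI[of _ 1])
    next
      case (Suc n)
      then obtain p where p: "p \<in> UA" "P p" and le: "norm (adj p * w - 1) \<le> (3 / 4) ^ n / 2" by blast
      define v where "v = adj p * w"
      have v: "v \<in> UA" unfolding v_def by (intro UA_mult UA_adj p w)
      define a where "a = (v - adj v) /\<^sub>R 2"
      have a: "a \<in> range emb" "adj a = - a"
        using v unitaries0_subset skew_part_in_range_emb
        by (auto simp: a_def adj_scaleR adj_diff adj_adj simp flip: scaleR_minus_right
            intro!: closed_ideal_scaleR[OF closed_ideal_range_emb])
      have "(3 / 4) ^ n / 2 \<le> (1 / 2 :: real)" by (simp add: power_le_one)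
      then have v1: "norm (v - 1) \<le> 1 / 2" using le by (simp add: v_def)
      have "norm (adj (p * cexp a) * w - 1) = norm (adj (cexp a) * v - 1)"
        by (simp add: adj_mult v_def mult.assoc)
      also have "\<dots> \<le> 3 / 2 * (norm (v - 1))\<^sup>2"
        unfolding a_def using v1 by (intro norm_cexp_skew_part_le UA_unitary v) simp
      also have "\<dots> = 3 / 2 * norm (v - 1) * norm (v - 1)" by (simp add: power2_eq_square)
      also have "\<dots> \<le> 3 / 4 * norm (v - 1)" using v1 by (intro mult_right_mono) auto
      also have "\<dots> \<le> (3 / 4) ^ Suc n / 2" using le by (simp add: v_def)
      finally show ?case
        using mult[OF p(1) cexp_in_unitaries0[OF closed_ideal_UNIV a] p(2) cexp[OF a]]
          UA_mult[OF p(1) cexp_in_unitaries0[OF closed_ideal_UNIV a]] by blast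
    qed
    have "\<exists>p\<in>{u. P u}. dist p w < e" if e: "e > 0" for e :: real
    proof -
      obtain n where n: "(3 / 4 :: real) ^ n < e" using real_arch_pow_inv[of e "3 / 4"] e by auto
      obtain p where p: "p \<in> UA" "P p" "norm (adj p * w - 1) \<le> (3 / 4) ^ n / 2"
        using appr by blast
      have "dist p w = norm (adj p * (w - p))"
        using UA_unitary[OF p(1)] by (simp add: norm_unitary_mult_left unitary_adj dist_norm norm_minus_commute)
      also have "\<dots> = norm (adj p * w - 1)"
        using UA_unitary[OF p(1)] by (simp add: right_diff_distrib unitary_def)
      also have "\<dots> \<le> (3 / 4) ^ n / 2" by (rule p(3))
      also have "(3 / 4 :: real) ^ n / 2 \<le> (3 / 4) ^ n" by simp
      finally show ?thesis using p n by force
    qed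
    then have "w \<in> closure {u. P u}" by (simp add: closure_approachable)
    then show ?thesis using P by simp
  qed
  define T where "T = {u \<in> UA. P u}"
  have "closedin (top_of_set UA) T"
    using P unfolding closedin_closed T_def by blast
  moreover have "openin (top_of_set UA) T"
    unfolding openin_contains_ball
  proof (intro conjI ballI)
    fix v assume "v \<in> T"
    then have v: "v \<in> UA" "P v" by (auto simp: T_def)
    have "P w" if w: "w \<in> UA" "dist v w < 1 / 2" for w
    proof -
      have "norm (adj v * w - 1) = norm (adj v * (w - v))"
        using UA_unitary[OF v(1)] by (simp add: right_diff_distrib unitary_def)
      also have "\<dots> = dist v w"
        using UA_unitary[OF v(1)] by (simp add: norm_unitary_mult_left unitary_adj dist_norm norm_minus_commute)
      finally have "P (adj v * w)" using w v by (intro near UA_mult UA_adj) auto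
      then have "P (v * (adj v * w))" using w v by (simp add: mult UA_mult UA_adj)
      then show ?thesis using UA_unitary[OF v(1)] by (simp add: unitary_def flip: mult.assoc)
    qed
    then show "\<exists>e>0. ball v e \<inter> UA \<subseteq> T" by (intro exI[of _ "1 / 2"]) (auto simp: T_def)
  qed (auto simp: T_def)
  moreover have "connected UA" by (simp add: unitaries0_def)
  moreover have "1 \<in> T" using near by (simp add: T_def unitaries0_one)
  ultimately have "T = UA" unfolding connected_clopen by blast
  then show ?thesis using u by (auto simp: T_def)
qed

section \<open>Closed normal subgroups and their tangent directions\<close>

locale closed_normal =
  fixes N :: "'a::cstar_algebra unitization set"
  assumes closed: "closed N"
    and one: "1 \<in> N"
    and mult: "x \<in> N \<Longrightarrow> y \<in> N \<Longrightarrow> x * y \<in> N"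
    and adj: "x \<in> N \<Longrightarrow> adj x \<in> N"
    and conj: "x \<in> N \<Longrightarrow> u \<in> UA \<Longrightarrow> u * x * adj u \<in> N"
begin

definition tangent :: "'a unitization set" where
  "tangent = {x. adj x = - x \<and> (\<forall>t. cexp (t *\<^sub>R x) \<in> N)}"

lemma tangent_skew: "x \<in> tangent \<Longrightarrow> adj x = - x"
  by (simp add: tangent_def)

lemma power: "x \<in> N \<Longrightarrow> x ^ n \<in> N"
  by (induction n) (simp_all add: one mult)

lemma limit: "(\<And>n. f n \<in> N) \<Longrightarrow> f \<longlonglongrightarrow> x \<Longrightarrow> x \<in> N"
  by (rule closed_sequentially[OF closed])

lemma tangent_zero: "0 \<in> tangent"
  by (simp add: tangent_def adj_zero cexp_zero one)

lemma tangent_scaleR: "x \<in> tangent \<Longrightarrow> r *\<^sub>R x \<in> tangent"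
  by (simp add: tangent_def adj_scaleR)

text \<open>The subgroup is closed under products and limits, so the Lie--Trotter formula applies.\<close>

lemma tangent_add:
  assumes "x \<in> tangent" "y \<in> tangent" shows "x + y \<in> tangent"
proof -
  have "cexp (t *\<^sub>R (x + y)) \<in> N" for t
  proof (rule limit)
    have "adj (t *\<^sub>R x) = - (t *\<^sub>R x)" "adj (t *\<^sub>R y) = - (t *\<^sub>R y)"
      using assms by (simp_all add: adj_scaleR tangent_skew)
    then show "(\<lambda>n. (cexp ((t *\<^sub>R x) /\<^sub>R real n) * cexp ((t *\<^sub>R y) /\<^sub>R real n)) ^ n) \<longlonglongrightarrow> cexp (t *\<^sub>R (x + y))"
      unfolding scaleR_add_right by (rule cexp_trotter)
    show "(cexp ((t *\<^sub>R x) /\<^sub>R real n) * cexp ((t *\<^sub>R y) /\<^sub>R real n)) ^ n \<in> N" for n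
      using assms by (intro power mult) (simp_all add: tangent_def)
  qed
  then show ?thesis using assms by (simp add: tangent_def adj_add)
qed

lemma tangent_closed: "closed tangent"
  unfolding closed_sequential_limits
proof (intro allI impI, elim conjE)
  fix f x assume f: "\<forall>n. f n \<in> tangent" and lim: "f \<longlonglongrightarrow> x"
  have "(\<lambda>n. adj (f n)) \<longlonglongrightarrow> adj x" by (rule bounded_linear.tendsto[OF bounded_linear_adj lim])
  moreover have "(\<lambda>n. adj (f n)) \<longlonglongrightarrow> - x"
    using tendsto_minus[OF lim] f by (simp add: tangent_skew)
  ultimately have sk: "adj x = - x" by (rule LIMSEQ_unique)
  have "cexp (t *\<^sub>R x) \<in> N" for t
  proof (rule limit)
    show "cexp (t *\<^sub>R f n) \<in> N" for n using f by (simp add: tangent_def)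
    have n0: "(\<lambda>n. norm (t *\<^sub>R f n - t *\<^sub>R x)) \<longlonglongrightarrow> 0"
      by (intro tendsto_norm_zero LIM_zero tendsto_scaleR tendsto_const lim)
    have le: "norm (cexp (t *\<^sub>R f n) - cexp (t *\<^sub>R x)) \<le> norm (t *\<^sub>R f n - t *\<^sub>R x)" for n
      using f by (intro cexp_lipschitz) (simp_all add: adj_scaleR tangent_skew sk)
    have "(\<lambda>n. cexp (t *\<^sub>R f n) - cexp (t *\<^sub>R x)) \<longlonglongrightarrow> 0"
      by (rule Lim_null_comparison[OF eventuallyI[OF le] n0])
    then show "(\<lambda>n. cexp (t *\<^sub>R f n)) \<longlonglongrightarrow> cexp (t *\<^sub>R x)" by (rule LIM_zero_cancel)
  qed
  then show "x \<in> tangent" using sk by (simp add: tangent_def)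
qed

text \<open>By the Lie--Trotter formula \<open>exp (t (u c u\<^sup>* - c))\<close> is the limit of the \<open>n\<close>-th powers of
\<open>exp (t u c u\<^sup>* / n) exp (- t c / n)\<close>, and this product is the commutator of \<open>u\<close> and \<open>exp (t c / n)\<close>.\<close>

lemma conj_diff_in_tangent:
  assumes u: "unitary u" and c: "adj c = - c"
    and comm: "\<And>t. u * cexp (t *\<^sub>R c) * adj u * adj (cexp (t *\<^sub>R c)) \<in> N"
  shows "u * c * adj u - c \<in> tangent"
proof -
  have "cexp (t *\<^sub>R (u * c * adj u - c)) \<in> N" for t
  proof (rule limit)
    define x where "x = t *\<^sub>R (u * c * adj u)"
    have "adj x = - x" "adj (- (t *\<^sub>R c)) = - (- (t *\<^sub>R c))"
      by (simp_all add: x_def adj_scaleR adj_mult adj_adj c adj_minus mult.assoc)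
    then show "(\<lambda>n. (cexp (x /\<^sub>R real n) * cexp (- (t *\<^sub>R c) /\<^sub>R real n)) ^ n) \<longlonglongrightarrow>
        cexp (t *\<^sub>R (u * c * adj u - c))"
      using cexp_trotter[of x "- (t *\<^sub>R c)"] by (simp add: x_def scaleR_diff_right)
    have "cexp (x /\<^sub>R real n) * cexp (- (t *\<^sub>R c) /\<^sub>R real n) \<in> N" for n
    proof -
      have "x /\<^sub>R real n = u * ((t / real n) *\<^sub>R c) * adj u"
        by (simp add: x_def divide_inverse mult.commute)
      moreover have "- (t *\<^sub>R c) /\<^sub>R real n = adj ((t / real n) *\<^sub>R c)"
        by (simp add: adj_scaleR c divide_inverse mult.commute)
      ultimately show ?thesis
        using comm[of "t / real n"] by (simp only: cexp_conj[OF u] adj_cexp)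
    qed
    then show "(cexp (x /\<^sub>R real n) * cexp (- (t *\<^sub>R c) /\<^sub>R real n)) ^ n \<in> N" for n by (rule power)
  qed
  moreover have "adj (u * c * adj u - c) = - (u * c * adj u - c)"
    by (simp add: adj_diff adj_mult adj_adj c mult.assoc)
  ultimately show ?thesis by (simp add: tangent_def)
qed

text \<open>Modulo a normal subgroup, \<open>(p q)\<^sup>n = p\<^sup>n\<close> when \<open>q\<close> belongs to it.\<close>

lemma power_mult_modulo:
  assumes p: "p \<in> UA" and q: "q \<in> N"
  shows "(p * q) ^ n * adj (p ^ n) \<in> N"
proof (induction n)
  case (Suc n)
  have "(p * q) ^ Suc n * adj (p ^ Suc n) = p * (q * ((p * q) ^ n * adj (p ^ n))) * adj p"
    by (simp add: adj_mult mult.assoc)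
  then show ?case using conj[OF mult[OF q Suc] p] by simp
qed (simp add: adj_one one)

text \<open>With \<open>d = u a u\<^sup>* - a\<close> tangent, \<open>u (exp a) u\<^sup>* = exp (a + d)\<close> is the limit of
\<open>(exp (a/n) exp (d/n))\<^sup>n\<close>, which is \<open>exp a\<close> modulo \<open>N\<close>.\<close>

lemma commutator_in:
  assumes u: "unitary u" and a: "a \<in> range emb" "adj a = - a"
    and d: "u * a * adj u - a \<in> tangent"
  shows "u * cexp a * adj u * adj (cexp a) \<in> N"
proof -
  define d where "d = u * a * adj u - a"
  have "u * cexp a * adj u = cexp (a + d)" by (simp add: d_def cexp_conj[OF u])
  moreover have "cexp (a + d) * adj (cexp a) \<in> N"
  proof (rule limit)
    define p q where "p n = cexp (a /\<^sub>R real (Suc n))" and "q n = cexp (d /\<^sub>R real (Suc n))" for n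
    have "p n ^ Suc n = cexp a" for n by (simp add: p_def del: of_nat_Suc power_Suc flip: cexp_power)
    moreover have "p n \<in> UA" for n
      unfolding p_def using a by (intro cexp_in_unitaries0[OF closed_ideal_UNIV]
        closed_ideal_scaleR[OF closed_ideal_range_emb]) (simp_all add: adj_scaleR)
    moreover have "q n \<in> N" for n using d by (simp add: q_def d_def tangent_def)
    ultimately show "(p n * q n) ^ Suc n * adj (cexp a) \<in> N" for n
      using power_mult_modulo[of "p n" "q n" "Suc n"] by simp
    have "(\<lambda>n. (cexp (a /\<^sub>R real n) * cexp (d /\<^sub>R real n)) ^ n) \<longlonglongrightarrow> cexp (a + d)"
      using d by (intro cexp_trotter a) (simp add: d_def tangent_def)
    from LIMSEQ_Suc[OF this] show "(\<lambda>n. (p n * q n) ^ Suc n * adj (cexp a)) \<longlonglongrightarrow> cexp (a + d) * adj (cexp a)"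
      unfolding p_def q_def by (rule tendsto_mult_right)
  qed
  ultimately show ?thesis by simp
qed

text \<open>The condition on \<open>w\<close> is closed, and it is multiplicative by
\<open>(x, u v) = (x, u) u (x, v) u\<^sup>*\<close>.\<close>

lemma commutators_in:
  assumes x: "unitary x" and w: "w \<in> UA"
    and tan: "\<And>a. a \<in> range emb \<Longrightarrow> adj a = - a \<Longrightarrow> x * a * adj x - a \<in> tangent"
  shows "x * w * adj x * adj w \<in> N"
  using w
proof (induction rule: UA_topological_induct)
  case lim
  have "continuous_on UNIV (\<lambda>w::'a unitization. x * w * adj x * adj w)"
    by (intro continuous_intros linear_continuous_on bounded_linear_adj)
  from closed_vimage[OF closed this] show ?case by (simp add: vimage_def)
next
  case (exp a)
  then show ?case by (intro commutator_in x tan)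
next
  case (prod u v)
  have "adj x * (x * y) = y" "adj u * (u * y) = y" for y
    using x UA_unitary[OF prod(1)] by (simp_all add: unitary_def flip: mult.assoc)
  then have "x * (u * v) * adj x * adj (u * v)
      = (x * u * adj x * adj u) * (u * (x * v * adj x * adj v) * adj u)"
    by (simp add: adj_mult mult.assoc)
  then show ?case using mult conj prod by simp
qed

text \<open>The complexification \<open>tangent + \<i> tangent\<close>, described by the skew-adjoint and self-adjoint parts of its
elements; in this form it is visibly closed.\<close>

definition ctangent :: "'a unitization set" where
  "ctangent = {x. x - adj x \<in> tangent \<and> \<i> *\<^sub>C (x + adj x) \<in> tangent}"

lemma tangent_of_ctangent: "x \<in> ctangent \<Longrightarrow> adj x = - x \<Longrightarrow> x \<in> tangent"
  using tangent_scaleR[of "x - adj x" "1/2"] by (simp add: ctangent_def flip: scaleR_2)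

lemma ctangent_closed: "closed ctangent"
proof -
  have "closed ((\<lambda>x. x - adj x) -` tangent \<inter> (\<lambda>x. \<i> *\<^sub>C (x + adj x)) -` tangent)"
    by (intro closed_Int closed_vimage tangent_closed continuous_intros
        linear_continuous_on[OF bounded_linear_adj]
        linear_continuous_on[OF bounded_linear_compose[OF bounded_linear_scaleC]]
        bounded_linear_add bounded_linear_ident bounded_linear_adj)
  then show ?thesis by (simp add: ctangent_def vimage_def Int_def)
qed

lemma ctangent_subspace: "complex_vector.subspace ctangent"
proof (rule complex_vector.subspaceI)
  show "0 \<in> ctangent" by (simp add: ctangent_def adj_zero tangent_zero)
next
  fix x y assume "x \<in> ctangent" "y \<in> ctangent"
  then have "(x - adj x) + (y - adj y) \<in> tangent" "\<i> *\<^sub>C (x + adj x) + \<i> *\<^sub>C (y + adj y) \<in> tangent"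
    by (auto simp: ctangent_def intro: tangent_add)
  then show "x + y \<in> ctangent" by (simp add: ctangent_def adj_add algebra_simps scaleC_add_right)
next
  fix c x assume x: "x \<in> ctangent"
  define p q where "p = Re c" and "q = Im c"
  have "c = of_real p + of_real q * \<i>" by (simp add: p_def q_def complex_eq_iff)
  then have cx: "c *\<^sub>C x = p *\<^sub>R x + q *\<^sub>R \<i> *\<^sub>C x"
    by (simp add: scaleC_add_left scaleC_scaleC scaleR_scaleC)
  have acx: "adj (c *\<^sub>C x) = p *\<^sub>R adj x - q *\<^sub>R \<i> *\<^sub>C adj x"
    unfolding cx by (simp add: adj_add adj_scaleR adj_scaleC)
  have i: "\<i> *\<^sub>C r *\<^sub>R y = r *\<^sub>R \<i> *\<^sub>C y" "\<i> *\<^sub>C \<i> *\<^sub>C y = - y" for r and y :: "'a unitization"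
    by (simp_all add: scaleR_scaleC scaleC_scaleC mult.commute scaleC_one)
  have "c *\<^sub>C x - adj (c *\<^sub>C x) = p *\<^sub>R (x - adj x) + q *\<^sub>R (\<i> *\<^sub>C (x + adj x))"
    unfolding acx unfolding cx by (simp add: scaleR_diff_right scaleC_add_right scaleR_add_right)
  moreover have "\<i> *\<^sub>C (c *\<^sub>C x + adj (c *\<^sub>C x)) = p *\<^sub>R (\<i> *\<^sub>C (x + adj x)) + (- q) *\<^sub>R (x - adj x)"
    unfolding acx unfolding cx
    by (simp add: scaleR_diff_right scaleC_add_right scaleR_add_right complex_vector.scale_right_diff_distrib i)
  ultimately show "c *\<^sub>C x \<in> ctangent"
    using x by (auto simp: ctangent_def intro!: tangent_add tangent_scaleR simp del: scaleR_minus_left)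
qed

text \<open>Split \<open>a\<close> into its skew-adjoint part and \<open>\<i>\<close> times a skew-adjoint element.\<close>

lemma conj_diff_in_ctangent:
  assumes u: "unitary u" and a: "a \<in> range emb"
    and tan: "\<And>a. a \<in> range emb \<Longrightarrow> adj a = - a \<Longrightarrow> u * a * adj u - a \<in> tangent"
  shows "u * a * adj u - a \<in> ctangent"
proof -
  have aa: "adj a \<in> range emb" using a by (auto simp flip: emb_adj)
  let ?b = "a - adj a" and ?c = "\<i> *\<^sub>C (a + adj a)"
  have "u * ?b * adj u - ?b \<in> tangent"
    using aa a by (intro tan closed_ideal_diff[OF closed_ideal_range_emb]) (simp_all add: adj_diff adj_adj)
  moreover have "u * ?c * adj u - ?c \<in> tangent"
    using aa a by (intro tan closed_ideal_scale[OF closed_ideal_range_emb] closed_ideal_add[OF closed_ideal_range_emb])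
      (simp_all add: adj_scaleC adj_add adj_adj add.commute)
  ultimately show ?thesis
    by (simp add: ctangent_def adj_diff adj_mult adj_adj algebra_simps
        mult_scaleC_left mult_scaleC_right scaleC_add_right complex_vector.scale_right_diff_distrib)
qed

end

section \<open>Closed commutator subgroups\<close>

lemma comm_subgroup_eq:
  assumes "X \<subseteq> UA"
  shows "comm_subgroup unitary_group0 X UA
    = generate unitary_group0 {x * y * adj x * adj y | x y. x \<in> X \<and> y \<in> UA}"
proof -
  have "{x \<otimes>\<^bsub>unitary_group0\<^esub> y \<otimes>\<^bsub>unitary_group0\<^esub> inv\<^bsub>unitary_group0\<^esub> x \<otimes>\<^bsub>unitary_group0\<^esub> inv\<^bsub>unitary_group0\<^esub> y |x y. x \<in> X \<and> y \<in> UA}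
     = {x * y * adj x * adj y | x y. x \<in> X \<and> y \<in> UA}"
  proof -
    have eq: "x \<otimes>\<^bsub>unitary_group0\<^esub> y \<otimes>\<^bsub>unitary_group0\<^esub> inv\<^bsub>unitary_group0\<^esub> x \<otimes>\<^bsub>unitary_group0\<^esub> inv\<^bsub>unitary_group0\<^esub> y
      = x * y * adj x * adj y" if "x \<in> X" "y \<in> UA" for x y
      using that assms UA_inv[of x] UA_inv[of y] by (auto simp: unitary_group0_def)
    show ?thesis by (intro Collect_cong iff_exI) (auto simp: eq)
  qed
  then show ?thesis by (simp add: comm_subgroup_def)
qed

lemma closure_comm_subgroup_subset:
  assumes N: "closed_normal N" and X: "X \<subseteq> UA"
    and comm: "\<And>x y. x \<in> X \<Longrightarrow> y \<in> UA \<Longrightarrow> x * y * adj x * adj y \<in> N"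
  shows "closure (comm_subgroup unitary_group0 X UA) \<subseteq> N"
proof (rule closure_minimal)
  show "closed N" by (rule closed_normal.closed[OF N])
  have S: "{x * y * adj x * adj y | x y. x \<in> X \<and> y \<in> UA} \<subseteq> UA"
    using X by (auto intro!: UA_mult UA_adj)
  show "comm_subgroup unitary_group0 X UA \<subseteq> N"
    unfolding comm_subgroup_eq[OF X]
  proof
    fix z assume "z \<in> generate unitary_group0 {x * y * adj x * adj y | x y. x \<in> X \<and> y \<in> UA}"
    then show "z \<in> N"
    proof (induction rule: generate.induct)
      case one then show ?case using closed_normal.one[OF N] by (simp add: unitary_group0_def)
    next
      case (incl h) then show ?case using comm by blast
    next
      case (inv h)
      then have "inv\<^bsub>unitary_group0\<^esub> h = adj h" "h \<in> N" using S UA_inv comm by blast+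
      then show ?case using closed_normal.adj[OF N] by simp
    next
      case (eng g h) then show ?case using closed_normal.mult[OF N] by (simp add: unitary_group0_def)
    qed
  qed
qed

lemma closed_normal_closure_comm_subgroup:
  assumes X: "X \<subseteq> UA" and conj: "\<And>x u. x \<in> X \<Longrightarrow> u \<in> UA \<Longrightarrow> u * x * adj u \<in> X"
  shows "closed_normal (closure (comm_subgroup unitary_group0 X UA))"
proof -
  define S where "S = {x * y * adj x * adj y | x y. x \<in> X \<and> y \<in> UA}"
  define G where "G = generate unitary_group0 S"
  have S: "S \<subseteq> UA" using X by (auto simp: S_def intro!: UA_mult UA_adj)
  interpret group "unitary_group0 :: 'a unitization monoid" by (rule group_unitary_group0)
  have sub: "subgroup G unitary_group0"
    unfolding G_def using S by (intro generate_is_subgroup) (simp add: unitary_group0_def)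
  have GU: "G \<subseteq> UA" using subgroup.subset[OF sub] by (simp add: unitary_group0_def)
  have G1: "1 \<in> G" using subgroup.one_closed[OF sub] by (simp add: unitary_group0_def)
  have Gm: "x * y \<in> G" if "x \<in> G" "y \<in> G" for x y
    using subgroup.m_closed[OF sub that] by (simp add: unitary_group0_def)
  have Ga: "adj x \<in> G" if "x \<in> G" for x
    using subgroup.m_inv_closed[OF sub that] that GU UA_inv[of x] by auto
  have Sc: "u * s * adj u \<in> S" if "s \<in> S" and u: "u \<in> UA" for s u
  proof -
    obtain x y where s: "s = x * y * adj x * adj y" "x \<in> X" "y \<in> UA" using \<open>s \<in> S\<close> by (auto simp: S_def)
    have c: "adj u * (u * z) = z" for z using UA_unitary[OF u] by (simp add: unitary_def flip: mult.assoc)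
    have "u * s * adj u = (u * x * adj u) * (u * y * adj u) * adj (u * x * adj u) * adj (u * y * adj u)"
      by (simp add: s adj_mult adj_adj mult.assoc c)
    moreover have "u * x * adj u \<in> X" "u * y * adj u \<in> UA" using s u by (auto intro: conj UA_mult UA_adj)
    ultimately show ?thesis unfolding S_def by blast
  qed
  have Gc: "u * g * adj u \<in> G" if "g \<in> G" and u: "u \<in> UA" for g u
    using \<open>g \<in> G\<close>[unfolded G_def]
  proof (induction rule: generate.induct)
    case one
    then show ?case using UA_unitary[OF u] G1 by (simp add: unitary_def unitary_group0_def)
  next
    case (incl h)
    then show ?case unfolding G_def by (intro generate.incl Sc u)
  next
    case (inv h)
    have "u * adj h * adj u = adj (u * h * adj u)" by (simp add: adj_mult adj_adj mult.assoc)
    moreover have "u * h * adj u \<in> G" unfolding G_def by (intro generate.incl Sc u inv)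
    ultimately show ?case using inv S UA_inv[of h] Ga by auto
  next
    case (eng g h)
    have c: "adj u * (u * z) = z" for z using UA_unitary[OF u] by (simp add: unitary_def flip: mult.assoc)
    have "u * (g * h) * adj u = (u * g * adj u) * (u * h * adj u)" by (simp add: mult.assoc c)
    then show ?case using Gm[OF eng.IH] by (simp add: unitary_group0_def)
  qed
  have "closed_normal (closure G)"
  proof
    show "closed (closure G)" by simp
    show "1 \<in> closure G" using G1 closure_subset by blast
    fix x assume "x \<in> closure G"
    then obtain f where f: "\<And>n. f n \<in> G" "f \<longlonglongrightarrow> x" by (auto simp: closure_sequential)
    show "adj x \<in> closure G"
      unfolding closure_sequential
      using f(1) Ga bounded_linear.tendsto[OF bounded_linear_adj f(2)]
      by (intro exI[of _ "\<lambda>n. adj (f n)"]) simp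
    show "u * x * adj u \<in> closure G" if "u \<in> UA" for u
      unfolding closure_sequential
      using f Gc[OF _ that] by (intro exI[of _ "\<lambda>n. u * f n * adj u"]) (auto intro!: tendsto_intros)
    fix y assume "y \<in> closure G"
    then obtain g where g: "\<And>n. g n \<in> G" "g \<longlonglongrightarrow> y" by (auto simp: closure_sequential)
    show "x * y \<in> closure G"
      unfolding closure_sequential
      using f g Gm by (intro exI[of _ "\<lambda>n. f n * g n"]) (auto intro!: tendsto_intros)
  qed
  then show ?thesis by (simp add: G_def S_def comm_subgroup_eq[OF X])
qed

lemma commutator_in_closure:
  assumes X: "X \<subseteq> UA" and "x \<in> X" "y \<in> UA"
  shows "x * y * adj x * adj y \<in> closure (comm_subgroup unitary_group0 X UA)"
proof -
  have "x * y * adj x * adj y \<in> comm_subgroup unitary_group0 X UA"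
    unfolding comm_subgroup_eq[OF X] using assms by (intro generate.incl) blast
  then show ?thesis using closure_subset by blast
qed

section \<open>The ideal of a normal subgroup\<close>

lemma power_in_normal:
  fixes H :: "'a::cstar_algebra unitization set"
  assumes "H \<lhd> unitary_group0" "h \<in> H" shows "h ^ n \<in> H"
proof -
  have sub: "subgroup H unitary_group0" by (rule normal_imp_subgroup[OF assms(1)])
  show ?thesis
  proof (induction n)
    case 0
    then show ?case using subgroup.one_closed[OF sub] by (simp add: unitary_group0_def)
  next
    case (Suc n)
    then show ?case using subgroup.m_closed[OF sub assms(2)] by (simp add: unitary_group0_def)
  qed
qed

lemma unitary_conj_diff: "unitary u \<Longrightarrow> u * a * adj u - a = u * (a * adj u) - a * adj u * u"
  by (simp add: unitary_def mult.assoc)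

lemma normal_subset:
  fixes H :: "'a::cstar_algebra unitization set"
  assumes "H \<lhd> unitary_group0" shows "H \<subseteq> UA"
  using subgroup.subset[OF normal_imp_subgroup[OF assms]] by (simp add: unitary_group0_def)

lemma normal_conj:
  fixes H :: "'a::cstar_algebra unitization set"
  assumes "H \<lhd> unitary_group0" "h \<in> H" "u \<in> UA" shows "u * h * adj u \<in> H"
  using normal.inv_op_closed2[OF assms(1), of u h] assms UA_inv[of u] by (simp add: unitary_group0_def)

text \<open>For skew-adjoint \<open>a\<close> in the algebra, \<open>[a, h]\<close> is a limit of difference quotients of the curve
\<open>exp (t a) h exp (- t a)\<close>, which stays in \<open>H\<close>. The general case follows by linearity, since scalars are
central.\<close>

lemma closure_span_normal_lie:
  fixes H :: "'a::cstar_algebra unitization set"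
  assumes H: "H \<lhd> unitary_group0" and x: "x \<in> closure (complex_vector.span H)"
  shows "x * a - a * x \<in> closure (complex_vector.span H)"
proof -
  define L where "L = closure (complex_vector.span H)"
  have L: "closed L" and Ls: "complex_vector.subspace L"
    by (simp_all add: L_def complex_subspace_closure)
  have HL: "h \<in> H \<Longrightarrow> h \<in> complex_vector.span H" for h by (rule complex_vector.span_base)
  have skew: "h * a - a * h \<in> L" if h: "h \<in> H" and a: "a \<in> range emb" "adj a = - a" for h a
  proof -
    have quot: "real (Suc n) *\<^sub>R (cexp (a /\<^sub>R real (Suc n)) * h * adj (cexp (a /\<^sub>R real (Suc n))) - h)
        \<in> complex_vector.span H" for n
      unfolding scaleR_scaleC[of "real (Suc n)"]
      by (intro complex_vector.span_scale complex_vector.span_diff HL normal_conj[OF H] h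
          cexp_in_unitaries0[OF closed_ideal_UNIV] closed_ideal_scaleR[OF closed_ideal_range_emb] a)
        (simp add: adj_scaleR a)
    have "a * h - h * a \<in> L"
      unfolding L_def closure_sequential
      by (intro exI conjI allI, rule quot, rule conj_difference_quotient[OF a(2)])
    from complex_vector.subspace_neg[OF Ls this] show ?thesis by simp
  qed
  have emb: "h * a - a * h \<in> L" if h: "h \<in> H" and a: "a \<in> range emb" for h a
  proof -
    have aa: "adj a \<in> range emb" using a by (auto simp flip: emb_adj)
    define p q where "p = a - adj a" and "q = \<i> *\<^sub>C (a + adj a)"
    have "h * p - p * h \<in> L" using aa a unfolding p_def
      by (intro skew h closed_ideal_diff[OF closed_ideal_range_emb]) (simp_all add: adj_diff adj_adj)
    moreover have "h * q - q * h \<in> L" using aa a unfolding q_def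
      by (intro skew h closed_ideal_scale[OF closed_ideal_range_emb] closed_ideal_add[OF closed_ideal_range_emb])
        (simp_all add: adj_scaleC adj_add adj_adj add.commute)
    ultimately have mem: "(1/2) *\<^sub>C ((h * p - p * h) + (- \<i>) *\<^sub>C (h * q - q * h)) \<in> L"
      by (intro complex_vector.subspace_scale[OF Ls] complex_vector.subspace_add[OF Ls])
    have aeq: "a = (1/2) *\<^sub>C (p + (- \<i>) *\<^sub>C q)"
    proof -
      have "p + (- \<i>) *\<^sub>C q = a + a" by (simp add: p_def q_def scaleC_scaleC scaleC_one)
      also have "\<dots> = 2 *\<^sub>C a" using scaleC_add_left[of 1 1 a] by (simp add: scaleC_one)
      finally have "p + (- \<i>) *\<^sub>C q = 2 *\<^sub>C a" .
      then show ?thesis by (simp add: scaleC_scaleC scaleC_one)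
    qed
    have "h * a - a * h = (1/2) *\<^sub>C ((h * p - p * h) + (- \<i>) *\<^sub>C (h * q - q * h))"
      by (subst (1 2) aeq) (simp add: mult_scaleC_left mult_scaleC_right algebra_simps scaleC_add_right
          complex_vector.scale_right_diff_distrib)
    then show ?thesis using mem by (simp only:)
  qed
  have "H \<subseteq> {w. \<forall>a\<in>UNIV. w * a - a * w \<in> L}"
  proof (intro subsetI CollectI ballI)
    fix h a assume "h \<in> H"
    have "h * a - a * h = h * emb (part a) - emb (part a) * h"
      by (subst (1 2) unitization_decomp[of a])
        (simp add: algebra_simps mult_scaleC_left mult_scaleC_right)
    then show "h * a - a * h \<in> L" using emb[OF \<open>h \<in> H\<close>, of "emb (part a)"] by simp
  qed
  then have "L \<subseteq> {w. \<forall>a\<in>UNIV. w * a - a * w \<in> L}"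
    unfolding L_def
    by (intro closure_minimal complex_vector.span_minimal
        closed_commuting_into subspace_commuting_into L[unfolded L_def] Ls[unfolded L_def])
  then show ?thesis using x by (auto simp: L_def)
qed

context
  fixes H :: "'a::cstar_algebra unitization set" and I :: "'a set"
  assumes H: "H \<lhd> unitary_group0"
    and I: "I = closed_ideal hull {x. emb x \<in> comm_span H (range emb)}"
begin

lemma closed_ideal_generated: "closed_ideal I"
  unfolding I by (rule closed_ideal_hull)

lemma commutator_in_generated_ideal:
  assumes "h \<in> H" "a \<in> range emb" shows "h * a - a * h \<in> emb ` I"
proof -
  have "h * a - a * h \<in> comm_span H (range emb)"
    unfolding comm_span_def using assms by (intro complex_vector.span_base) blast
  moreover from this obtain x where "h * a - a * h = emb x" using comm_span_subset by blast
  ultimately show ?thesis unfolding I by (auto intro!: imageI hull_inc)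
qed

lemma conj_diff_in_generated_ideal:
  assumes "h \<in> H" "a \<in> range emb" shows "h * a * adj h - a \<in> emb ` I"
proof -
  have "unitary h" using assms normal_subset[OF H] UA_unitary by blast
  then have "h * a * adj h - a = (h * a - a * h) * adj h"
    by (simp add: left_diff_distrib mult.assoc unitary_def)
  then show ?thesis
    using closed_ideal_right[OF closed_ideal_image_emb[OF closed_ideal_generated] commutator_in_generated_ideal[OF assms]] by simp
qed

text \<open>Here \<open>N\<close> is meant to contain \<open>(U\<^sub>I, U\<^sub>A)\<close>. For \<open>c \<in> I\<close> the difference \<open>h c h\<^sup>* - c\<close> is tangent,
as \<open>exp (t c) \<in> U\<^sub>I\<close>; the ergodic limit reduces a general \<open>a\<close> to this case.\<close>

lemma normal_subgroup_commutators_in: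
  assumes N: "closed_normal N"
    and comm: "\<And>v u. v \<in> unitaries0 I \<Longrightarrow> u \<in> UA \<Longrightarrow> v * u * adj v * adj u \<in> N"
    and h: "h \<in> H" and u: "u \<in> UA"
  shows "h * u * adj h * adj u \<in> N"
proof -
  interpret closed_normal N by (rule N)
  have hU: "h \<in> UA" and hu: "unitary h" using h normal_subset[OF H] UA_unitary by blast+
  have J: "closed_ideal (emb ` I)" by (rule closed_ideal_image_emb[OF closed_ideal_generated])
  have tan: "h * c * adj h - c \<in> tangent" if c: "c \<in> emb ` I" "adj c = - c" for c
  proof (rule conj_diff_in_tangent[OF hu c(2)])
    fix t
    have "cexp (t *\<^sub>R c) \<in> unitaries0 I"
      by (intro cexp_in_unitaries0 closed_ideal_generated closed_ideal_scaleR[OF J] c) (simp add: adj_scaleR c)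
    \<comment> \<open>the inverse of a commutator is the commutator with its arguments exchanged\<close>
    from adj[OF comm[OF this hU]]
    show "h * cexp (t *\<^sub>R c) * adj h * adj (cexp (t *\<^sub>R c)) \<in> N"
      by (simp add: adj_mult adj_adj mult.assoc)
  qed
  show ?thesis
  proof (rule commutators_in[OF hu u])
    fix a :: "'a unitization" assume a: "a \<in> range emb" "adj a = - a"
    define c where "c n = (\<Sum>k<Suc n. a - h ^ k * a * adj (h ^ k)) /\<^sub>R real (Suc n)" for n
    have cI: "a - h ^ k * a * adj (h ^ k) \<in> emb ` I" for k
      using complex_vector.subspace_neg[OF closed_ideal_subspace[OF J] conj_diff_in_generated_ideal[OF power_in_normal[OF H h] a(1)]]
      by simp
    have "c n \<in> emb ` I" for n
      unfolding c_def by (intro closed_ideal_scaleR[OF J] complex_vector.subspace_sum closed_ideal_subspace[OF J] cI)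
    moreover have "adj (c n) = - c n" for n
    proof -
      have sk: "adj (\<Sum>k<m. a - h ^ k * a * adj (h ^ k)) = - (\<Sum>k<m. a - h ^ k * a * adj (h ^ k))" for m
        by (induction m) (simp_all add: adj_zero adj_add adj_diff adj_mult adj_adj a mult.assoc)
      show ?thesis by (simp only: c_def adj_scaleR sk scaleR_minus_right)
    qed
    ultimately have "h * c n * adj h - c n \<in> tangent" for n by (rule tan)
    then show "h * a * adj h - a \<in> tangent"
      using closed_sequentially[OF tangent_closed _ conj_diff_ergodic_limit[OF hu, of a]]
      unfolding c_def by blast
  qed
qed

text \<open>Here \<open>N\<close> is meant to contain \<open>(H, U\<^sub>A)\<close>. The elements \<open>w\<close> with \<open>[w, A]\<close> inside the complexified
tangent space contain \<open>H\<close>, hence the Lie ideal \<open>L\<close> spanned by it, products of two elements of \<open>L\<close>, and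
finally the whole ideal \<open>I\<close>. A commutator of \<open>v = 1 + x\<close>, where \<open>x \<in> I\<close>, with an exponential is thereby controlled by
\<open>[x, a v\<^sup>*]\<close>.\<close>

lemma ideal_commutators_in:
  assumes N: "closed_normal N"
    and comm: "\<And>h u. h \<in> H \<Longrightarrow> u \<in> UA \<Longrightarrow> h * u * adj h * adj u \<in> N"
    and v: "v \<in> unitaries0 I" and u: "u \<in> UA"
  shows "v * u * adj v * adj u \<in> N"
proof -
  interpret closed_normal N by (rule N)
  define L where "L = closure (complex_vector.span H)"
  define W where "W = {w. \<forall>a\<in>range emb. w * a - a * w \<in> ctangent}"
  have J: "closed_ideal (range emb :: 'a unitization set)" by (rule closed_ideal_range_emb)
  have W: "closed W" unfolding W_def by (rule closed_commuting_into[OF ctangent_closed])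
  have Ws: "complex_vector.subspace W" unfolding W_def by (rule subspace_commuting_into[OF ctangent_subspace])
  have "H \<subseteq> W"
  proof
    fix h assume h: "h \<in> H"
    then have hU: "h \<in> UA" and hu: "unitary h" using normal_subset[OF H] UA_unitary by blast+
    have "h * b - b * h \<in> ctangent" if b: "b \<in> range emb" for b
    proof -
      \<comment> \<open>Conjugation differences of elements of \<open>A\<close> exhaust \<open>[h, A]\<close>, because \<open>A h = A\<close>.\<close>
      define a where "a = b * h"
      have a: "a \<in> range emb" unfolding a_def by (rule closed_ideal_right[OF J b])
      have "h * a * adj h - a \<in> ctangent"
      proof (rule conj_diff_in_ctangent[OF hu a])
        fix c :: "'a unitization" assume c: "c \<in> range emb" "adj c = - c"
        show "h * c * adj h - c \<in> tangent"
          by (intro conj_diff_in_tangent hu c comm h cexp_in_unitaries0[OF closed_ideal_UNIV]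
              closed_ideal_scaleR[OF J]) (simp add: adj_scaleR c)
      qed
      moreover have "h * a * adj h - a = h * b - b * h"
        using hu by (simp add: a_def mult.assoc unitary_def)
      ultimately show ?thesis by simp
    qed
    then show "h \<in> W" by (simp add: W_def)
  qed
  then have LW: "L \<subseteq> W"
    unfolding L_def by (intro closure_minimal complex_vector.span_minimal Ws W)
  have LLW: "x * y \<in> W" if xy: "x \<in> L" "y \<in> L" for x y
  proof -
    have "x * y * a - a * (x * y) \<in> ctangent" if a: "a \<in> range emb" for a
    proof -
      \<comment> \<open>\<open>[x y, a] = [x, y a] + [y, a x]\<close>, where \<open>y a\<close> and \<open>a x\<close> are again in \<open>A\<close>\<close>
      have "x * (y * a) - (y * a) * x \<in> ctangent" "y * (a * x) - (a * x) * y \<in> ctangent"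
        using xy LW closed_ideal_left[OF J a, of y] closed_ideal_right[OF J a, of x] by (auto simp: W_def)
      then have "(x * (y * a) - (y * a) * x) + (y * (a * x) - (a * x) * y) \<in> ctangent"
        by (rule complex_vector.subspace_add[OF ctangent_subspace])
      then show ?thesis by (simp add: algebra_simps)
    qed
    then show ?thesis by (simp add: W_def)
  qed
  have Ls: "complex_vector.subspace L" unfolding L_def by (simp add: complex_subspace_closure)
  have Lie: "x * a - a * x \<in> L" if "x \<in> L" for x a
    using that unfolding L_def by (rule closure_span_normal_lie[OF H])
  define K where "K = closed_ideal hull {x * y - y * x | x y. x \<in> L \<and> y \<in> L}"
  have K: "closed_ideal K" unfolding K_def by (rule closed_ideal_hull)
  have KW: "K \<subseteq> W" unfolding K_def by (rule lie_hull_subset[OF Ls Lie W Ws LW LLW])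
  have "I \<subseteq> emb -` K"
    unfolding I
  proof (rule hull_minimal)
    show "closed_ideal (emb -` K)" by (rule closed_ideal_vimage_emb[OF K])
    have "comm_span H (range emb) \<subseteq> K"
      unfolding comm_span_def
    proof (rule complex_vector.span_minimal[OF _ closed_ideal_subspace[OF K]], clarify)
      fix h and a :: 'a assume "h \<in> H"
      then have hL: "h \<in> L" unfolding L_def using closure_subset complex_vector.span_base by blast
      show "h * emb a - emb a * h \<in> K"
        unfolding K_def by (rule commutator_in_lie_hull[OF _ hL]) (rule Lie)
    qed
    then show "{x. emb x \<in> comm_span H (range emb)} \<subseteq> emb -` K" by blast
  qed
  then have IW: "emb x \<in> W" if "x \<in> I" for x using that KW by blast
  obtain x where x: "x \<in> I" "v = 1 + emb x" and vu: "unitary v"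
    using v unitaries0_subset by (force simp: unitaries_def)
  show ?thesis
  proof (rule commutators_in[OF vu u])
    fix a :: "'a unitization" assume a: "a \<in> range emb" "adj a = - a"
    have "v * a * adj v - a = emb x * (a * adj v) - a * adj v * emb x"
      unfolding unitary_conj_diff[OF vu] by (simp add: x(2) algebra_simps)
    also have "\<dots> \<in> ctangent"
      using IW[OF x(1)] closed_ideal_right[OF J a(1), of "adj v"] unfolding W_def by blast
    finally show "v * a * adj v - a \<in> tangent"
      by (rule tangent_of_ctangent) (simp add: adj_diff adj_mult adj_adj a mult.assoc)
  qed
qed

end

theorem theorem3p3:
  fixes H :: "'a::cstar_algebra unitization set" and I :: "'a set"
  assumes "H \<lhd> unitary_group0"
    and "I = closed_ideal hull {x. emb x \<in> comm_span H (range emb)}"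
  shows "closure (comm_subgroup unitary_group0 H (unitaries0 (UNIV :: 'a set)))
       = closure (comm_subgroup unitary_group0 (unitaries0 I) (unitaries0 (UNIV :: 'a set)))"
proof (rule equalityI)
  note HU = normal_subset[OF assms(1)]
  have IU: "unitaries0 I \<subseteq> UA" by (rule unitaries0_mono) simp
  have I: "closed_ideal I" by (rule closed_ideal_generated[OF assms])
  show "closure (comm_subgroup unitary_group0 H (unitaries0 (UNIV :: 'a set)))
       \<subseteq> closure (comm_subgroup unitary_group0 (unitaries0 I) (unitaries0 (UNIV :: 'a set)))" (is "_ \<subseteq> ?N")
  proof (rule closure_comm_subgroup_subset[OF _ HU])
    show N: "closed_normal ?N"
      by (rule closed_normal_closure_comm_subgroup[OF IU]) (rule unitaries0_conj[OF I UA_unitary])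
    show "h * u * adj h * adj u \<in> ?N" if "h \<in> H" "u \<in> UA" for h u
      using N commutator_in_closure[OF IU] that by (rule normal_subgroup_commutators_in[OF assms])
  qed
  show "closure (comm_subgroup unitary_group0 (unitaries0 I) (unitaries0 (UNIV :: 'a set)))
      \<subseteq> closure (comm_subgroup unitary_group0 H (unitaries0 (UNIV :: 'a set)))" (is "_ \<subseteq> ?N")
  proof (rule closure_comm_subgroup_subset[OF _ IU])
    show N: "closed_normal ?N"
      by (rule closed_normal_closure_comm_subgroup[OF HU]) (rule normal_conj[OF assms(1)])
    show "v * u * adj v * adj u \<in> ?N" if "v \<in> unitaries0 I" "u \<in> UA" for v u
      using N commutator_in_closure[OF HU] that by (rule ideal_commutators_in[OF assms])
  qed
qed

end
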